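(* Let $N\ge2$, let $(p_i)_{i\ge1}$ be positive, $0\le r<t$ integers, $\bm y\in\mathsf{W}_N$, and assume $1<q_1<q_2<\dots<q_N$. The (signed) determinantal point process $\mathbb{P}(\mathsf{X}_N\mid\bm y)$ defined in the context, with expectation denoted by $\mathbb{E}$, admits the Fredholm determinant representation $$\mathbb{E}\Big[\prod_{1\le j\le i\le N}\big(1+g(i,x_j^{(i)})\big)\Big]=\det(I+gK)_{\ell^2(\{1,\dots,N\}\times\mathbb{Z})}$$ for any bounded test function $g:\{1,\dots,N\}\times\mathbb{Z}\to\mathbb{R}$, where the correlation kernel is $$K(m,x;n,x')=-Q_{(m,n]}(x,x')\mathbf{1}_{\{n>m\}}+\sum_{i,j=1}^N\Psi_i^{(m)}(x)\,[\mathsf{M}^{-1}]_{i,j}\,Q_{[j,n]}(x_0^{(j-1)},x'),$$ and the matrix $\mathsf{M}$ is defined by $$\mathsf{M}_{i,j}:=\sum_{z\in\mathbb{Z}}Q_{[i,N]}(x_0^{(i-1)},z)\,\Psi_j^{(N)}(z),\qquad1\le i,j\le N.$$ Furthermore, $\mathsf{M}$ is upper-triangular and invertible.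
   Context: $\mathsf{W}_N=\{\bm y\in\mathbb{Z}^N:y_1\ge\dots\ge y_N\}$. Kernels on $\mathbb{Z}\times\mathbb{Z}$, composed by $(A\circ B)(x,z)=\sum_yA(x,y)B(y,z)$: $Q_i(x,y)=q_i^{y-x}\mathbf{1}_{\{y<x\}}$; $Q_i^{-1}(x,y)=-\mathbf{1}_{y=x}+q_i\mathbf{1}_{y=x+1}$; $R_i(x,y)=\mathbf{1}_{y=x}+p_i\mathbf{1}_{y=x+1}$; $R_i^*(x,y)=R_i(y,x)$; $R^*_{(r,t]}=R_t^*\circ\cdots\circ R_{r+1}^*$; $Q_{(m,n]}=Q_{m+1}\circ\cdots\circ Q_n$ for $m<n$; $Q^{-1}_{(k,N]}=Q_N^{-1}\circ\cdots\circ Q_{k+1}^{-1}$ (identity if $k=N$). $\Psi_k^{(N)}(x):=\big(R^*_{(r,t]}\circ Q^{-1}_{(k,N]}\big)(x,y_k-k)$ for $1\le k\le N$, and $\Psi_k^{(n)}(x):=\sum_{z\in\mathbb{Z}}Q_{(n,N]}(x,z)\Psi_k^{(N)}(z)$ for $1\le n<N$. Virtual variables $x_0^{(j-1)}$ (regarded as $\infty$): $Q_k(x_0^{(k-1)},y):=q_k^y$; $Q_{[j,k]}(x_0^{(j-1)},x):=q_j^{x+k-j}/\prod_{\ell=j+1}^k(q_\ell-q_j)$ for $1\le j\le k$, and $:=0$ for $1\le k<j$. The signed measure is defined on integer configurations $\mathsf{X}_N=\{x_j^{(i)}\}_{1\le j\le i\le N}$ with $x_{j+1}^{(i+1)}<x_j^{(i)}\le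 x_j^{(i+1)}$ by $$\mathbb{P}(\mathsf{X}_N\mid\bm y)=\frac1{\bar Z}\prod_{k=1}^N\det\big(Q_k(x_{i-1}^{(k-1)},x_j^{(k)})\big)_{i,j=1}^k\cdot\det\big(\Psi_i^{(N)}(x_j^{(N)})\big)_{i,j=1}^N,$$ $$\bar Z=(-1)^{N(N-1)/2}\prod_{j=1}^N\prod_{i=r+1}^t(1+p_iq_j)\cdot\prod_{j=1}^Nq_j^{y_j-j},$$ where the entries in the first row ($i=1$) of the $k$-th determinant, which involve the virtual variable $x_0^{(k-1)}$, are $Q_k(x_0^{(k-1)},x_j^{(k)})=q_k^{x_j^{(k)}}$; $\mathbb{E}[F]=\sum_{\mathsf{X}_N}F(\mathsf{X}_N)\mathbb{P}(\mathsf{X}_N\mid\bm y)$. $\det(I+A)_{\ell^2(X)}=\sum_{d\ge0}\frac1{d!}\sum_{u_1,\dots,u_d\in X}\det(A(u_a,u_b))_{a,b=1}^d$, and $(gK)(m,x;n,x')=g(m,x)K(m,x;n,x')$. *)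

theory Defs
  imports
    "HOL-Analysis.Infinite_Sum"
    "Jordan_Normal_Form.Determinant"
    "Jordan_Normal_Form.Gauss_Jordan_Elimination"
begin

text \<open>
  Families and matrices are indexed from 1, as in the mathematics; the entry \<open>(i, j)\<close> of a family is
  stored at position \<open>(i - 1, j - 1)\<close> of the library matrix.
\<close>

definition mat_of1 :: "nat \<Rightarrow> (nat \<Rightarrow> nat \<Rightarrow> real) \<Rightarrow> real mat" where
  "mat_of1 n f = mat n n (\<lambda>(i, j). f (i + 1) (j + 1))"


subsection \<open>Kernels on the integers\<close>

type_synonym kernel = "int \<Rightarrow> int \<Rightarrow> real"

definition kcomp :: "kernel \<Rightarrow> kernel \<Rightarrow> kernel" where
  "kcomp A B x z = (\<Sum>\<^sub>\<infinity>y. A x y * B y z)"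

definition kid :: kernel where
  "kid x y = of_bool (y = x)"

definition kprod :: "kernel list \<Rightarrow> kernel" where
  "kprod As = foldr kcomp As kid"

definition Qker :: "(nat \<Rightarrow> real) \<Rightarrow> nat \<Rightarrow> kernel" where
  "Qker q i x y = (q i powi (y - x)) * of_bool (y < x)"

definition Qinv :: "(nat \<Rightarrow> real) \<Rightarrow> nat \<Rightarrow> kernel" where
  "Qinv q i x y = - of_bool (y = x) + q i * of_bool (y = x + 1)"

definition Rker :: "(nat \<Rightarrow> real) \<Rightarrow> nat \<Rightarrow> kernel" where
  "Rker p i x y = of_bool (y = x) + p i * of_bool (y = x + 1)"

definition Rstar :: "(nat \<Rightarrow> real) \<Rightarrow> nat \<Rightarrow> kernel" where
  "Rstar p i x y = Rker p i y x"

text \<open>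
  The products over half-open index ranges. Note the order of the factors: ascending for \<open>Qprod\<close>,
  descending for \<open>Rstar_prod\<close> and \<open>Qinv_prod\<close>. All the sums over the integers that compose
  these kernels, here and in the next subsection, have only finitely many nonzero terms.
\<close>

definition Rstar_prod :: "(nat \<Rightarrow> real) \<Rightarrow> nat \<Rightarrow> nat \<Rightarrow> kernel" where
  "Rstar_prod p r t = kprod (map (Rstar p) (rev [r + 1..<t + 1]))"

definition Qprod :: "(nat \<Rightarrow> real) \<Rightarrow> nat \<Rightarrow> nat \<Rightarrow> kernel" where
  "Qprod q m n = kprod (map (Qker q) [m + 1..<n + 1])"

definition Qinv_prod :: "(nat \<Rightarrow> real) \<Rightarrow> nat \<Rightarrow> nat \<Rightarrow> kernel" where
  "Qinv_prod q k N = kprod (map (Qinv q) (rev [k + 1..<N + 1]))"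


subsection \<open>The functions \<open>\<Psi>\<close>, the virtual variables and the matrix \<open>M\<close>\<close>

definition PsiN ::
  "nat \<Rightarrow> (nat \<Rightarrow> real) \<Rightarrow> (nat \<Rightarrow> real) \<Rightarrow> nat \<Rightarrow> nat \<Rightarrow> (nat \<Rightarrow> int) \<Rightarrow> nat \<Rightarrow> int \<Rightarrow> real" where
  "PsiN N q p r t y k x = kcomp (Rstar_prod p r t) (Qinv_prod q k N) x (y k - int k)"

text \<open>\<open>Psi N q p r t y n k\<close> has level \<open>n\<close> and index \<open>k\<close>.\<close>

definition Psi ::
  "nat \<Rightarrow> (nat \<Rightarrow> real) \<Rightarrow> (nat \<Rightarrow> real) \<Rightarrow> nat \<Rightarrow> nat \<Rightarrow> (nat \<Rightarrow> int) \<Rightarrow> nat \<Rightarrow> nat \<Rightarrow> int \<Rightarrow> real" where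
  "Psi N q p r t y n k x =
     (if n < N then (\<Sum>\<^sub>\<infinity>z. Qprod q n N x z * PsiN N q p r t y k z)
      else PsiN N q p r t y k x)"

text \<open>
  The virtual variable is not represented by a value; the kernels evaluated at it are functions of
  their remaining argument: \<open>Qvirt q k x\<close> is \<open>Q\<^sub>k\<close> at the virtual variable of level \<open>k - 1\<close>, and
  \<open>Qvirt_range q j k x\<close> is the kernel of the closed range \<open>[j, k]\<close> at the one of level \<open>j - 1\<close>.
\<close>

definition Qvirt :: "(nat \<Rightarrow> real) \<Rightarrow> nat \<Rightarrow> int \<Rightarrow> real" where
  "Qvirt q k x = q k powi x"

definition Qvirt_range :: "(nat \<Rightarrow> real) \<Rightarrow> nat \<Rightarrow> nat \<Rightarrow> int \<Rightarrow> real" where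
  "Qvirt_range q j k x =
     (if j \<le> k then (q j powi (x + int k - int j)) / (\<Prod>l = j + 1..k. q l - q j) else 0)"

definition Mmat ::
  "nat \<Rightarrow> (nat \<Rightarrow> real) \<Rightarrow> (nat \<Rightarrow> real) \<Rightarrow> nat \<Rightarrow> nat \<Rightarrow> (nat \<Rightarrow> int) \<Rightarrow> real mat" where
  "Mmat N q p r t y =
     mat_of1 N (\<lambda>i j. \<Sum>\<^sub>\<infinity>z. Qvirt_range q i N z * PsiN N q p r t y j z)"

definition corr_kernel ::
  "nat \<Rightarrow> (nat \<Rightarrow> real) \<Rightarrow> (nat \<Rightarrow> real) \<Rightarrow> nat \<Rightarrow> nat \<Rightarrow> (nat \<Rightarrow> int)
     \<Rightarrow> nat \<times> int \<Rightarrow> nat \<times> int \<Rightarrow> real" where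
  "corr_kernel N q p r t y = (\<lambda>(m, x) (n, x').
     - (Qprod q m n x x' * of_bool (n > m))
     + (\<Sum>i = 1..N. \<Sum>j = 1..N.
          Psi N q p r t y m i x * (the (mat_inverse (Mmat N q p r t y)) $$ (i - 1, j - 1))
            * Qvirt_range q j n x'))"


subsection \<open>The signed measure on interlacing configurations\<close>

text \<open>\<open>X (i, j)\<close> is the \<open>j\<close>-th particle of level \<open>i\<close>.\<close>

definition tri_index :: "nat \<Rightarrow> (nat \<times> nat) set" where
  "tri_index N = {(i, j). 1 \<le> j \<and> j \<le> i \<and> i \<le> N}"

definition configs :: "nat \<Rightarrow> (nat \<times> nat \<Rightarrow> int) set" where
  "configs N = {X \<in> tri_index N \<rightarrow>\<^sub>E UNIV.
     \<forall>i j. 1 \<le> j \<and> j \<le> i \<and> i < N \<longrightarrow> X (i + 1, j + 1) < X (i, j) \<and> X (i, j) \<le> X (i + 1, j)}"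

definition Qlevel :: "(nat \<Rightarrow> real) \<Rightarrow> (nat \<times> nat \<Rightarrow> int) \<Rightarrow> nat \<Rightarrow> nat \<Rightarrow> nat \<Rightarrow> real" where
  "Qlevel q X k i j =
     (if i = 1 then Qvirt q k (X (k, j)) else Qker q k (X (k - 1, i - 1)) (X (k, j)))"

definition Zbar ::
  "nat \<Rightarrow> (nat \<Rightarrow> real) \<Rightarrow> (nat \<Rightarrow> real) \<Rightarrow> nat \<Rightarrow> nat \<Rightarrow> (nat \<Rightarrow> int) \<Rightarrow> real" where
  "Zbar N q p r t y =
     (-1) ^ (N * (N - 1) div 2) * (\<Prod>j = 1..N. \<Prod>i = r + 1..t. 1 + p i * q j)
       * (\<Prod>j = 1..N. q j powi (y j - int j))"

definition signed_weight ::
  "nat \<Rightarrow> (nat \<Rightarrow> real) \<Rightarrow> (nat \<Rightarrow> real) \<Rightarrow> nat \<Rightarrow> nat \<Rightarrow> (nat \<Rightarrow> int)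
     \<Rightarrow> (nat \<times> nat \<Rightarrow> int) \<Rightarrow> real" where
  "signed_weight N q p r t y X =
     1 / Zbar N q p r t y
       * (\<Prod>k = 1..N. det (mat_of1 k (Qlevel q X k)))
       * det (mat_of1 N (\<lambda>i j. PsiN N q p r t y i (X (N, j))))"

definition signed_expectation ::
  "nat \<Rightarrow> (nat \<Rightarrow> real) \<Rightarrow> (nat \<Rightarrow> real) \<Rightarrow> nat \<Rightarrow> nat \<Rightarrow> (nat \<Rightarrow> int)
     \<Rightarrow> ((nat \<times> nat \<Rightarrow> int) \<Rightarrow> real) \<Rightarrow> real" where
  "signed_expectation N q p r t y F =
     (\<Sum>\<^sub>\<infinity>X\<in>configs N. F X * signed_weight N q p r t y X)"


subsection \<open>Fredholm determinants\<close>

definition fredholm_minor :: "('a \<Rightarrow> 'a \<Rightarrow> real) \<Rightarrow> nat \<Rightarrow> (nat \<Rightarrow> 'a) \<Rightarrow> real" where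
  "fredholm_minor A d u = det (mat d d (\<lambda>(a, b). A (u a) (u b)))"

definition fredholm_term :: "'a set \<Rightarrow> ('a \<Rightarrow> 'a \<Rightarrow> real) \<Rightarrow> nat \<Rightarrow> real" where
  "fredholm_term S A d = (1 / fact d) * (\<Sum>\<^sub>\<infinity>u\<in>{..<d} \<rightarrow>\<^sub>E S. fredholm_minor A d u)"

definition fredholm_det :: "'a set \<Rightarrow> ('a \<Rightarrow> 'a \<Rightarrow> real) \<Rightarrow> real" where
  "fredholm_det S A = (\<Sum>d. fredholm_term S A d)"

text \<open>
  Infinite sums default to 0 when they do not converge, so an identity involving
  \<open>fredholm_det\<close> is meaningful only together with the following condition.
\<close>

definition fredholm_converges :: "'a set \<Rightarrow> ('a \<Rightarrow> 'a \<Rightarrow> real) \<Rightarrow> bool" where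
  "fredholm_converges S A \<longleftrightarrow>
     (\<forall>d. fredholm_minor A d abs_summable_on ({..<d} \<rightarrow>\<^sub>E S)) \<and> summable (fredholm_term S A)"

end

theory Submission
  imports Defs
begin

text \<open>
  The proof is the conditional L-ensemble argument of Borodin and Rains, carried out in finite
  dimension.

  Every \<open>\<Psi>\<close> of level \<open>N\<close> has finite support, and interlacing confines a configuration to the interval
  spanned by its top row. Hence only finitely many configurations have nonzero weight, and they all
  live in a window \<open>{1..N} \<times> {lo..hi}\<close>. Fix any window containing it and let \<open>L\<close> be the square matrix indexed
  by \<open>N\<close> virtual points and the points of the window, with three nonzero blocks: from the virtual
  point \<open>k\<close> to level \<open>k\<close> by \<open>q\<^sub>k\<^sup>x\<close>, from level \<open>m\<close> to level \<open>m + 1\<close> by \<open>- Q\<^sub>m\<^sub>+\<^sub>1\<close>, and from level \<open>N\<close>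
  back to the virtual points by \<open>\<Psi>\<close>. A fixed permutation of the rows makes the principal minor of \<open>L\<close>
  at the virtual points and the points of a configuration block diagonal. Its blocks are the matrices in
  the weight up to row signs and a transposition, so this minor is a constant times the weight (\<open>pts_minor_eq_weight\<close>). Conversely, a
  set of points with a nonzero minor has \<open>k\<close> points on level \<open>k\<close>, and they interlace because otherwise
  two columns would be proportional (\<open>nonzero_minor_imp_config\<close>).

  Let \<open>A\<close> be \<open>L\<close> plus the identity on the window. Summing the minors of \<open>L\<close> over all sets of points that
  contain \<open>Y\<close> gives \<open>det (A - 1\<^sub>Y) = det A * det (1 - 1\<^sub>Y A\<^sup>-\<^sup>1)\<close>. So the correlation function of \<open>Y\<close> is the
  minor at \<open>Y\<close> of \<open>1 - A\<^sup>-\<^sup>1\<close>, and it remains to see that this matrix is the kernel \<open>K\<close>. In block form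
  \<open>A\<close> is \<open>[[0, E], [P, 1 - W]]\<close>; the inverse of \<open>1 - W\<close> consists of the kernels \<open>Q\<close> of ranges
  \<open>(m, n]\<close>, applying it to \<open>P\<close> gives \<open>\<Psi>\<close> of level \<open>m\<close>, and block inversion yields the formula for \<open>K\<close>
  except that the kernels \<open>Q\<close> of ranges \<open>[j, n]\<close> at the virtual variables, which are sums up to
  infinity, appear truncated at the top of the window. The truncation cancels: the missing tail of the
  geometric series is a multiple of \<open>q\<^sub>n\<^sup>x\<close>, that is, of a row of \<open>E\<close> (\<open>Qvirt_range_window\<close>), so it only
  changes the basis by a unitriangular matrix, and this matrix drops out of the product of the inverse
  of \<open>M\<close> with these functions (\<open>Bmat_left_inverse\<close>). The same row operation gives
  \<open>det A = (-1)\<^sup>N det M\<close>.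

  The matrix \<open>M\<close> is upper triangular because its entry \<open>(i, j)\<close> is, up to a factor, the generating function
  of \<open>\<Psi>\<^sub>j\<close> evaluated at \<open>q\<^sub>i\<close>, which contains the product of \<open>q\<^sub>l - q\<^sub>i\<close> over \<open>l > j\<close>.

  Since the minors of \<open>K\<close> are the correlation functions of a finitely supported signed measure, they
  vanish off a finite set. The Fredholm series is therefore a finite sum, and it agrees with the
  expansion of the expectation of \<open>\<Prod>(1 + g)\<close> over subsets of the configuration.
\<close>


section \<open>Determinants indexed by finite sets\<close>

text \<open>
  The determinant of an array whose rows and columns are indexed by the same finite set \<open>I\<close>. Minors at
  sets of points come without a canonical order of the points, and simultaneous
  reordering of rows and columns does not change their value.
\<close>
definition sdet :: "'a set \<Rightarrow> ('a \<Rightarrow> 'a \<Rightarrow> 'b :: comm_ring_1) \<Rightarrow> 'b" where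
  "sdet I f = (\<Sum>\<pi> | \<pi> permutes I. of_int (sign \<pi>) * (\<Prod>i\<in>I. f i (\<pi> i)))"

lemma sdet_empty [simp]: "sdet {} f = 1"
  by (simp add: sdet_def)

lemma sdet_cong:
  assumes "\<And>i j. i \<in> I \<Longrightarrow> j \<in> I \<Longrightarrow> f i j = g i j"
  shows "sdet I f = sdet I g"
  unfolding sdet_def using assms
  by (intro sum.cong refl arg_cong2[where f = "(*)"] prod.cong)
    (auto simp: permutes_in_image)

lemma sdet_reindex:
  assumes "finite I" "inj_on e I"
  shows "sdet (e ` I) f = sdet I (\<lambda>a b. f (e a) (e b))"
proof -
  have bij: "bij_betw e I (e ` I)"
    using assms by (simp add: bij_betw_def)
  have "sdet (e ` I) f =
      (\<Sum>\<pi> | \<pi> permutes I. of_int (sign (map_permutation I e \<pi>)) * (\<Prod>i\<in>e ` I. f i (map_permutation I e \<pi> i)))"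
    unfolding sdet_def
  proof (rule sum.reindex_bij_witness[where j = "map_permutation (e ` I) (inv_into I e)" and i = "map_permutation I e"])
    fix \<pi> assume "\<pi> \<in> {\<pi>. \<pi> permutes e ` I}"
    then have \<pi>: "\<pi> permutes e ` I" by simp
    have bij': "bij_betw (inv_into I e) (e ` I) I"
      using bij by (rule bij_betw_inv_into)
    show *: "map_permutation I e (map_permutation (e ` I) (inv_into I e) \<pi>) = \<pi>"
      by (rule map_permutation_compose_inv[OF bij' \<pi>])
        (use assms in \<open>auto simp: f_inv_into_f\<close>)
    show "map_permutation (e ` I) (inv_into I e) \<pi> \<in> {\<pi>. \<pi> permutes I}"
      using map_permutation_permutes[OF bij' \<pi>] by simp
    show "of_int (sign (map_permutation I e (map_permutation (e ` I) (inv_into I e) \<pi>))) *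
        (\<Prod>i\<in>e ` I. f i (map_permutation I e (map_permutation (e ` I) (inv_into I e) \<pi>) i)) =
        of_int (sign \<pi>) * (\<Prod>i\<in>e ` I. f i (\<pi> i))"
      by (simp add: *)
  next
    fix \<pi> assume "\<pi> \<in> {\<pi>. \<pi> permutes I}"
    then have \<pi>: "\<pi> permutes I" by simp
    show "map_permutation I e \<pi> \<in> {\<pi>. \<pi> permutes e ` I}"
      using map_permutation_permutes[OF bij \<pi>] by simp
    show "map_permutation (e ` I) (inv_into I e) (map_permutation I e \<pi>) = \<pi>"
      by (rule map_permutation_compose_inv[OF bij \<pi>])
        (use assms in auto)
  qed
  also have "\<dots> = sdet I (\<lambda>a b. f (e a) (e b))"
    unfolding sdet_def
  proof (rule sum.cong[OF refl], elim CollectE)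
    fix \<pi> assume \<pi>: "\<pi> permutes I"
    have "(\<Prod>i\<in>e ` I. f i (map_permutation I e \<pi> i)) = (\<Prod>i\<in>I. f (e i) (e (\<pi> i)))"
      using assms by (simp add: prod.reindex map_permutation_apply cong: prod.cong)
    then show "of_int (sign (map_permutation I e \<pi>)) * (\<Prod>i\<in>e ` I. f i (map_permutation I e \<pi> i)) =
        of_int (sign \<pi>) * (\<Prod>i\<in>I. f (e i) (e (\<pi> i)))"
      using assms \<pi> by (simp add: sign_map_permutation)
  qed
  finally show ?thesis .
qed

lemma det_eq_sdet: "det (mat n n (\<lambda>(a, b). f a b)) = sdet {0..<n} f"
  unfolding sdet_def
  by (subst det_def'[of _ n], simp)
    (auto intro!: sum.cong prod.cong arg_cong2[where f = "(*)"] simp: permutes_in_image)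

lemma det_eq_sdet_reindex:
  assumes "inj_on e {0..<n}"
  shows "det (mat n n (\<lambda>(a, b). f (e a) (e b))) = sdet (e ` {0..<n}) f"
  using sdet_reindex[OF _ assms, of f] det_eq_sdet[of n "\<lambda>a b. f (e a) (e b)"] by simp

lemma finite_enumeration:
  assumes "finite (I :: 'a set)"
  obtains e where "inj_on e {0..<card I}" "I = e ` {0..<card I}"
  using ex_bij_betw_nat_finite[OF assms] by (auto simp: bij_betw_def)

lemma sdet_transpose:
  assumes "finite (I :: 'a set)"
  shows "sdet I (\<lambda>i j. f j i) = sdet I f"
proof -
  obtain e where e: "inj_on e {0..<card I}" "I = e ` {0..<card I}"
    using finite_enumeration[OF assms] .
  define n where "n = card I"
  note e = e[folded n_def]
  have "sdet I (\<lambda>i j. f j i) = det (transpose_mat (mat n n (\<lambda>(a, b). f (e a) (e b))))"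
    unfolding e(2) det_eq_sdet_reindex[OF e(1), of "\<lambda>i j. f j i", symmetric]
    by (intro arg_cong[where f = det]) auto
  also have "\<dots> = sdet I f"
    using det_eq_sdet_reindex[OF e(1), of f] e(2) by (subst det_transpose) auto
  finally show ?thesis .
qed

lemma sdet_mult:
  assumes "finite (I :: 'a set)"
  shows "sdet I (\<lambda>i j. \<Sum>k\<in>I. f i k * g k j) = sdet I f * sdet I g"
proof -
  obtain e where e: "inj_on e {0..<card I}" "I = e ` {0..<card I}"
    using finite_enumeration[OF assms] .
  define n where "n = card I"
  note e = e[folded n_def]
  define F where "F = mat n n (\<lambda>(a, b). f (e a) (e b))"
  define G where "G = mat n n (\<lambda>(a, b). g (e a) (e b))"
  have sum_I: "(\<Sum>k\<in>I. h k) = (\<Sum>k = 0..<n. h (e k))" for h :: "'a \<Rightarrow> 'b"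
    unfolding e(2) by (simp add: sum.reindex[OF e(1)])
  have "sdet I (\<lambda>i j. \<Sum>k\<in>I. f i k * g k j) = det (F * G)"
    unfolding sum_I unfolding e(2) det_eq_sdet_reindex[OF e(1), symmetric]
    by (intro arg_cong[where f = det]) (auto simp: F_def G_def scalar_prod_def)
  also have "\<dots> = det F * det G"
    by (rule det_mult[of _ n]) (auto simp: F_def G_def)
  also have "\<dots> = sdet I f * sdet I g"
    using det_eq_sdet_reindex[OF e(1), of f] det_eq_sdet_reindex[OF e(1), of g] e(2)
    by (simp add: F_def G_def)
  finally show ?thesis .
qed

lemma sdet_scale_rows: "sdet I (\<lambda>i j. c i * f i j) = (\<Prod>i\<in>I. c i) * sdet I f"
  unfolding sdet_def sum_distrib_left
  by (intro sum.cong refl) (simp add: prod.distrib mult_ac)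

lemma sdet_permute_rows:
  assumes fin: "finite I" and p: "p permutes I"
  shows "sdet I (\<lambda>i j. f (p i) j) = of_int (sign p) * sdet I f"
proof -
  have "sdet I (\<lambda>i j. f (p i) j) =
      (\<Sum>\<pi> | \<pi> permutes I. of_int (sign (\<pi> \<circ> p)) * (\<Prod>i\<in>I. f (p i) ((\<pi> \<circ> p) i)))"
    unfolding sdet_def
  proof (rule sum.reindex_bij_witness[where i = "\<lambda>\<pi>. \<pi> \<circ> p" and j = "\<lambda>\<pi>. \<pi> \<circ> Hilbert_Choice.inv p"])
    fix \<pi> assume \<pi>: "\<pi> \<in> {\<pi>. \<pi> permutes I}"
    show "\<pi> \<circ> p \<circ> Hilbert_Choice.inv p = \<pi>"
      using permutes_inv_o(1)[OF p] by (simp add: comp_assoc)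
    show "\<pi> \<circ> p \<in> {\<pi>. \<pi> permutes I}"
      using \<pi> p by (auto intro: permutes_compose)
  next
    fix \<pi> assume \<pi>: "\<pi> \<in> {\<pi>. \<pi> permutes I}"
    show *: "\<pi> \<circ> Hilbert_Choice.inv p \<circ> p = \<pi>"
      using permutes_inv_o(2)[OF p] by (simp add: comp_assoc)
    show "\<pi> \<circ> Hilbert_Choice.inv p \<in> {\<pi>. \<pi> permutes I}"
      using \<pi> permutes_inv[OF p] by (auto intro: permutes_compose)
    show "of_int (sign (\<pi> \<circ> Hilbert_Choice.inv p \<circ> p)) * (\<Prod>i\<in>I. f (p i) ((\<pi> \<circ> Hilbert_Choice.inv p \<circ> p) i)) =
         of_int (sign \<pi>) * (\<Prod>i\<in>I. f (p i) (\<pi> i))"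
      by (simp only: *)
  qed
  also have "\<dots> = (\<Sum>\<pi> | \<pi> permutes I. of_int (sign p) * (of_int (sign \<pi>) * (\<Prod>i\<in>I. f i (\<pi> i))))"
  proof (rule sum.cong[OF refl], elim CollectE)
    fix \<pi> assume \<pi>: "\<pi> permutes I"
    have "(\<Prod>i\<in>I. f (p i) ((\<pi> \<circ> p) i)) = (\<Prod>i\<in>I. f i (\<pi> i))"
      using prod.permute[OF p, of "\<lambda>i. f i (\<pi> i)"] by (simp add: o_def)
    then show "of_int (sign (\<pi> \<circ> p)) * (\<Prod>i\<in>I. f (p i) ((\<pi> \<circ> p) i)) =
        of_int (sign p) * (of_int (sign \<pi>) * (\<Prod>i\<in>I. f i (\<pi> i)))"
      using sign_compose[of \<pi> p] permutes_imp_permutation[OF fin \<pi>] permutes_imp_permutation[OF fin p]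
      by (simp add: mult_ac)
  qed
  also have "\<dots> = of_int (sign p) * sdet I f"
    by (simp add: sdet_def sum_distrib_left)
  finally show ?thesis .
qed

text \<open>
  Only permutations fixing \<open>b\<close> contribute, and these are the permutations of \<open>I - {b}\<close>.
\<close>
lemma sdet_unit_row:
  assumes fin: "finite I" and b: "b \<in> I" and row: "\<And>j. j \<in> I \<Longrightarrow> f b j = of_bool (j = b)"
  shows "sdet I f = sdet (I - {b}) f"
proof -
  have "sdet I f = (\<Sum>\<pi> | \<pi> permutes (I - {b}). of_int (sign \<pi>) * (\<Prod>i\<in>I. f i (\<pi> i)))"
    unfolding sdet_def
  proof (rule sum.mono_neutral_right)
    show "finite {\<pi>. \<pi> permutes I}"
      using fin by (rule finite_permutations)
    show "{\<pi>. \<pi> permutes (I - {b})} \<subseteq> {\<pi>. \<pi> permutes I}"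
      by (auto intro: permutes_subset)
    show "\<forall>\<pi>\<in>{\<pi>. \<pi> permutes I} - {\<pi>. \<pi> permutes (I - {b})}.
        of_int (sign \<pi>) * (\<Prod>i\<in>I. f i (\<pi> i)) = 0"
    proof
      fix \<pi> assume "\<pi> \<in> {\<pi>. \<pi> permutes I} - {\<pi>. \<pi> permutes (I - {b})}"
      then have \<pi>: "\<pi> permutes I" "\<not> \<pi> permutes (I - {b})" by auto
      have "\<pi> b \<noteq> b"
        using \<pi> permutes_superset[OF \<pi>(1), of "I - {b}"] by auto
      then have "f b (\<pi> b) = 0"
        using row[of "\<pi> b"] b \<pi>(1) by (simp add: permutes_in_image)
      then have "(\<Prod>i\<in>I. f i (\<pi> i)) = 0"
        using fin b by (intro prod_zero) auto
      then show "of_int (sign \<pi>) * (\<Prod>i\<in>I. f i (\<pi> i)) = 0" by simp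
    qed
  qed
  also have "\<dots> = sdet (I - {b}) f"
    unfolding sdet_def
  proof (rule sum.cong[OF refl], elim CollectE)
    fix \<pi> assume \<pi>: "\<pi> permutes (I - {b})"
    have "\<pi> b = b"
      using \<pi> by (simp add: permutes_not_in)
    then have "(\<Prod>i\<in>I. f i (\<pi> i)) = (\<Prod>i\<in>I - {b}. f i (\<pi> i))"
      using row[OF b] fin b by (simp add: prod.remove)
    then show "of_int (sign \<pi>) * (\<Prod>i\<in>I. f i (\<pi> i)) = of_int (sign \<pi>) * (\<Prod>i\<in>I - {b}. f i (\<pi> i))"
      by simp
  qed
  finally show ?thesis .
qed

lemma sdet_unit_rows:
  assumes "finite B" "finite A" "A \<inter> B = {}"
    and "\<And>i j. i \<in> B \<Longrightarrow> j \<in> A \<union> B \<Longrightarrow> f i j = of_bool (j = i)"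
  shows "sdet (A \<union> B) f = sdet A f"
  using assms(1,3,4)
proof (induction B rule: finite_induct)
  case empty
  then show ?case by simp
next
  case (insert b B)
  have "sdet (A \<union> insert b B) f = sdet (A \<union> insert b B - {b}) f"
    using insert.prems insert.hyps assms(2) by (intro sdet_unit_row) auto
  also have "A \<union> insert b B - {b} = A \<union> B"
    using insert by auto
  also have "sdet (A \<union> B) f = sdet A f"
    using insert by (intro insert.IH) auto
  finally show ?case .
qed

text \<open>
  The array factors as \<open>diag(F\<^sub>A, 1)\<close> times an array that is the identity in the rows of \<open>A\<close>, so
  multiplicativity and the deletion of unit rows give the product.
\<close>
lemma sdet_block:
  fixes f :: "'a \<Rightarrow> 'a \<Rightarrow> 'b :: comm_ring_1"
  assumes fin: "finite A" "finite B" and disj: "A \<inter> B = {}"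
    and zero: "\<And>a b. a \<in> A \<Longrightarrow> b \<in> B \<Longrightarrow> f a b = 0"
  shows "sdet (A \<union> B) f = sdet A f * sdet B f"
proof -
  define f1 where "f1 = (\<lambda>i j. if i \<in> A then f i j else of_bool (j = i) :: 'b)"
  define f2 where "f2 = (\<lambda>i j. if i \<in> B then f i j else of_bool (j = i) :: 'b)"
  have "sdet (A \<union> B) f = sdet (A \<union> B) (\<lambda>i j. \<Sum>k\<in>A \<union> B. f1 i k * f2 k j)"
  proof (rule sdet_cong)
    fix i j assume i: "i \<in> A \<union> B" and j: "j \<in> A \<union> B"
    have "(\<Sum>k\<in>A \<union> B. f1 i k * f2 k j) = (\<Sum>k\<in>A. f1 i k * f2 k j) + (\<Sum>k\<in>B. f1 i k * f2 k j)"
      using fin disj by (rule sum.union_disjoint)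
    also have "(\<Sum>k\<in>A. f1 i k * f2 k j) = (\<Sum>k\<in>A. if k = j then f1 i k else 0)"
      using disj by (intro sum.cong) (auto simp: f2_def)
    also have "(\<Sum>k\<in>B. f1 i k * f2 k j) = (\<Sum>k\<in>B. if k = i then f k j else 0)"
      using i disj zero by (intro sum.cong) (auto simp: f1_def f2_def)
    finally show "f i j = (\<Sum>k\<in>A \<union> B. f1 i k * f2 k j)"
      using i j disj fin zero by (auto simp: f1_def)
  qed
  also have "\<dots> = sdet (A \<union> B) f1 * sdet (A \<union> B) f2"
    using fin by (intro sdet_mult) auto
  also have "sdet (A \<union> B) f1 = sdet A f1"
    using fin disj by (intro sdet_unit_rows) (auto simp: f1_def)
  also have "\<dots> = sdet A f"
    by (rule sdet_cong) (auto simp: f1_def)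
  also have "sdet (A \<union> B) f2 = sdet B f2"
    using fin disj by (subst Un_commute, intro sdet_unit_rows) (auto simp: f2_def)
  also have "\<dots> = sdet B f"
    by (rule sdet_cong) (auto simp: f2_def)
  finally show ?thesis .
qed

lemma sdet_block_diagonal:
  fixes f :: "'a \<Rightarrow> 'a \<Rightarrow> 'b :: comm_ring_1"
  assumes "finite T" "\<And>k. k \<in> T \<Longrightarrow> finite (I k)"
    and "\<And>k l a b. k \<in> T \<Longrightarrow> l \<in> T \<Longrightarrow> k \<noteq> l \<Longrightarrow> a \<in> I k \<Longrightarrow> b \<in> I l \<Longrightarrow> f a b = 0"
    and "\<And>k l. k \<in> T \<Longrightarrow> l \<in> T \<Longrightarrow> k \<noteq> l \<Longrightarrow> I k \<inter> I l = {}"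
  shows "sdet (\<Union>k\<in>T. I k) f = (\<Prod>k\<in>T. sdet (I k) f)"
  using assms
proof (induction T rule: finite_induct)
  case empty
  then show ?case by simp
next
  case (insert t T)
  have "sdet (I t \<union> (\<Union>k\<in>T. I k)) f = sdet (I t) f * sdet (\<Union>k\<in>T. I k) f"
  proof (rule sdet_block)
    show "finite (I t)" "finite (\<Union>k\<in>T. I k)"
      using insert.hyps(1) insert.prems(1) by (simp_all add: finite_UN)
    show "I t \<inter> (\<Union>k\<in>T. I k) = {}"
      using insert.prems(3)[of t] insert.hyps(2) by blast
    show "f a b = 0" if ab: "a \<in> I t" "b \<in> (\<Union>k\<in>T. I k)" for a b
    proof -
      obtain l where l: "l \<in> T" "b \<in> I l" using ab(2) by blast
      then have "t \<noteq> l" using insert.hyps(2) by blast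
      then show ?thesis
        using insert.prems(2)[of t l a b] l ab(1) by simp
    qed
  qed
  also have "sdet (\<Union>k\<in>T. I k) f = (\<Prod>k\<in>T. sdet (I k) f)"
  proof (rule insert.IH)
    show "f a b = 0" if "k \<in> T" "l \<in> T" "k \<noteq> l" "a \<in> I k" "b \<in> I l" for k l a b
      using that by (intro insert.prems(2)[of k l]) auto
    show "finite (I k)" if "k \<in> T" for k
      using that by (intro insert.prems(1)) auto
    show "I k \<inter> I l = {}" if "k \<in> T" "l \<in> T" "k \<noteq> l" for k l
      using that by (intro insert.prems(3)) auto
  qed
  finally show ?case
    using insert.hyps by simp
qed

lemma sdet_identical_rows:
  assumes fin: "finite I" and ij: "i \<in> I" "j \<in> I" "i \<noteq> j"
    and eq: "\<And>b. b \<in> I \<Longrightarrow> f i b = f j b"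
  shows "sdet I f = 0"
proof -
  obtain e where e: "inj_on e {0..<card I}" "I = e ` {0..<card I}"
    using finite_enumeration[OF fin] .
  define n where "n = card I"
  note e = e[folded n_def]
  have "i \<in> e ` {0..<n}" "j \<in> e ` {0..<n}"
    using ij(1,2) e(2) by blast+
  then obtain a b where ab: "a < n" "b < n" "e a = i" "e b = j"
    by (metis atLeastLessThan_iff imageE)
  define F where "F = mat n n (\<lambda>(a, b). f (e a) (e b))"
  have "det F = 0"
  proof (rule det_identical_rows[of F n a b])
    show "F \<in> carrier_mat n n" by (simp add: F_def)
    show "a \<noteq> b" using ab(3,4) ij(3) by blast
    have "e k \<in> I" if "k < n" for k
      using that e(2) by auto
    then show "row F a = row F b"
      using ab eq by (auto simp: F_def)
  qed (use ab in auto)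
  then show ?thesis
    using det_eq_sdet_reindex[OF e(1), of f] e(2) by (simp add: F_def)
qed

lemma sdet_proportional_columns:
  fixes f :: "'a \<Rightarrow> 'a \<Rightarrow> 'b :: comm_ring_1"
  assumes fin: "finite I" and ij: "i \<in> I" "j \<in> I" "i \<noteq> j"
    and eq: "\<And>b. b \<in> I \<Longrightarrow> f b i = c * f b j"
  shows "sdet I f = 0"
proof -
  define h where "h = (\<lambda>a b. if a = i then f b j else f b a)"
  have "sdet I f = sdet I (\<lambda>a b. f b a)"
    by (rule sdet_transpose[OF fin, symmetric])
  also have "\<dots> = sdet I (\<lambda>a b. (if a = i then c else 1) * h a b)"
    using eq by (intro sdet_cong) (auto simp: h_def)
  also have "\<dots> = (\<Prod>a\<in>I. if a = i then c else 1) * sdet I h"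
    by (rule sdet_scale_rows)
  also have "sdet I h = 0"
    using fin ij by (intro sdet_identical_rows[of I i j]) (auto simp: h_def)
  finally show ?thesis by simp
qed

text \<open>
  Along such a permutation one can follow the nonzero entries, which is how the points on each level will be
  counted.
\<close>
lemma sdet_nonzero_imp_permutation:
  fixes f :: "'a \<Rightarrow> 'a \<Rightarrow> 'b :: comm_ring_1"
  assumes "finite I" "sdet I f \<noteq> 0"
  shows "\<exists>\<pi>. \<pi> permutes I \<and> (\<forall>i\<in>I. f i (\<pi> i) \<noteq> 0)"
proof (rule ccontr)
  assume *: "\<not> ?thesis"
  have "sdet I f = 0"
    unfolding sdet_def
  proof (rule sum.neutral, safe)
    fix \<pi> assume "\<pi> permutes I"
    then obtain i where "i \<in> I" "f i (\<pi> i) = 0"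
      using * by blast
    then have "(\<Prod>i\<in>I. f i (\<pi> i)) = 0"
      using assms(1) by (intro prod_zero) blast+
    then show "of_int (sign \<pi>) * (\<Prod>i\<in>I. f i (\<pi> i)) = 0"
      by simp
  qed
  then show False using assms(2) by simp
qed

text \<open>
  Triangularity with respect to a rank function, so that no order of \<open>I\<close> has to be chosen. A permutation
  with a nonzero term never lowers the rank and raises it wherever it moves a point, which contradicts
  the invariance of the total rank unless it is the identity.
\<close>
lemma sdet_triangular:
  fixes f :: "'a \<Rightarrow> 'a \<Rightarrow> 'b :: comm_ring_1" and rk :: "'a \<Rightarrow> nat"
  assumes fin: "finite I"
    and tri: "\<And>i j. i \<in> I \<Longrightarrow> j \<in> I \<Longrightarrow> i \<noteq> j \<Longrightarrow> f i j \<noteq> 0 \<Longrightarrow> rk i < rk j"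
  shows "sdet I f = (\<Prod>i\<in>I. f i i)"
proof -
  have "sdet I f = (\<Sum>\<pi>\<in>{id}. of_int (sign \<pi>) * (\<Prod>i\<in>I. f i (\<pi> i)))"
    unfolding sdet_def
  proof (rule sum.mono_neutral_right)
    show "finite {\<pi>. \<pi> permutes I}"
      using fin by (rule finite_permutations)
    show "{id} \<subseteq> {\<pi>. \<pi> permutes I}"
      by (auto simp: permutes_id)
    show "\<forall>\<pi>\<in>{\<pi>. \<pi> permutes I} - {id}. of_int (sign \<pi>) * (\<Prod>i\<in>I. f i (\<pi> i)) = 0"
    proof (rule ballI, rule ccontr)
      fix \<pi> assume "\<pi> \<in> {\<pi>. \<pi> permutes I} - {id}"
      then have \<pi>: "\<pi> permutes I" and "\<pi> \<noteq> id" by auto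
      assume "of_int (sign \<pi>) * (\<Prod>i\<in>I. f i (\<pi> i)) \<noteq> 0"
      then have "(\<Prod>i\<in>I. f i (\<pi> i)) \<noteq> 0" by force
      then have "f i (\<pi> i) \<noteq> 0" if "i \<in> I" for i
        using that prod_zero[OF fin, of "\<lambda>i. f i (\<pi> i)"] by blast
      then have less: "rk i < rk (\<pi> i)" if "i \<in> I" "\<pi> i \<noteq> i" for i
        using that tri[of i "\<pi> i"] permutes_in_image[OF \<pi>, of i] by simp
      obtain b where b: "\<pi> b \<noteq> b"
        using \<open>\<pi> \<noteq> id\<close> by (metis eq_id_iff)
      then have "b \<in> I"
        using permutes_not_in[OF \<pi>, of b] by blast
      have "(\<Sum>i\<in>I. rk i) < (\<Sum>i\<in>I. rk (\<pi> i))"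
        proof (rule sum_strict_mono_ex1[OF fin])
        show "\<forall>i\<in>I. rk i \<le> rk (\<pi> i)"
          using less by (force simp: le_less)
        show "\<exists>i\<in>I. rk i < rk (\<pi> i)"
          using \<open>b \<in> I\<close> b less by blast
      qed
      moreover have "(\<Sum>i\<in>I. rk (\<pi> i)) = (\<Sum>i\<in>I. rk i)"
        using sum.permute[OF \<pi>, of rk] by (simp add: o_def)
      ultimately show False by simp
    qed
  qed
  then show ?thesis by simp
qed

text \<open>
  Multilinearity in the rows of \<open>B\<close>: each such row is either kept or replaced by a unit row, and a unit row
  deletes its index. With \<open>f\<close> the matrix \<open>L\<close>, this turns a sum of principal minors into one determinant.
\<close>
lemma sdet_add_diagonal:
  fixes f :: "'a \<Rightarrow> 'a \<Rightarrow> 'b :: comm_ring_1"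
  assumes "finite B" "finite I" "B \<subseteq> I"
  shows "sdet I (\<lambda>i j. f i j + of_bool (i = j \<and> i \<in> B)) = (\<Sum>S\<in>Pow B. sdet (I - S) f)"
  using assms
proof (induction B arbitrary: I rule: finite_induct)
  case empty
  then show ?case by simp
next
  case (insert b B)
  let ?f = "\<lambda>i j. f i j + of_bool (i = j \<and> i \<in> B)"
  let ?e = "\<lambda>i j. if i = b then of_bool (i = j) else ?f i j"
  have bI: "b \<in> I" and BI: "B \<subseteq> I" using insert.prems by auto
  have "sdet I (\<lambda>i j. f i j + of_bool (i = j \<and> i \<in> insert b B)) = sdet I ?f + sdet I ?e"
    unfolding sdet_def sum.distrib[symmetric]
  proof (rule sum.cong[OF refl])
    fix \<pi> :: "'a \<Rightarrow> 'a"
    let ?P = "\<Prod>i\<in>I - {b}. ?f i (\<pi> i)"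
    have split: "(\<Prod>i\<in>I. h i) = h b * (\<Prod>i\<in>I - {b}. h i)" for h :: "'a \<Rightarrow> 'b"
      using insert.prems bI by (simp add: prod.remove)
    have 1: "(\<Prod>i\<in>I. f i (\<pi> i) + of_bool (i = \<pi> i \<and> i \<in> insert b B))
        = (f b (\<pi> b) + of_bool (b = \<pi> b)) * ?P"
      unfolding split by (intro arg_cong2[where f = "(*)"] prod.cong) auto
    have 2: "(\<Prod>i\<in>I. ?f i (\<pi> i)) = f b (\<pi> b) * ?P"
      unfolding split using insert.hyps by simp
    have 3: "(\<Prod>i\<in>I. ?e i (\<pi> i)) = of_bool (b = \<pi> b) * ?P"
      unfolding split by (intro arg_cong2[where f = "(*)"] prod.cong) auto
    show "of_int (sign \<pi>) * (\<Prod>i\<in>I. f i (\<pi> i) + of_bool (i = \<pi> i \<and> i \<in> insert b B)) =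
        of_int (sign \<pi>) * (\<Prod>i\<in>I. ?f i (\<pi> i)) + of_int (sign \<pi>) * (\<Prod>i\<in>I. ?e i (\<pi> i))"
      unfolding 1 2 3 by (simp add: algebra_simps)
  qed
  also have "sdet I ?e = sdet (I - {b}) ?e"
    using insert.prems bI by (intro sdet_unit_row) auto
  also have "\<dots> = sdet (I - {b}) ?f"
    by (rule sdet_cong) auto
  also have "\<dots> = (\<Sum>S\<in>Pow B. sdet (I - {b} - S) f)"
    using insert by (intro insert.IH) auto
  also have "\<dots> = (\<Sum>S\<in>insert b ` Pow B. sdet (I - S) f)"
    using insert.hyps
    by (subst sum.reindex)
      (auto simp: inj_on_def set_diff_eq intro!: sum.cong arg_cong2[where f = sdet])
  also have "sdet I ?f = (\<Sum>S\<in>Pow B. sdet (I - S) f)"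
    using insert BI by (intro insert.IH) auto
  finally have "sdet I (\<lambda>i j. f i j + of_bool (i = j \<and> i \<in> insert b B)) =
      (\<Sum>S\<in>Pow B. sdet (I - S) f) + (\<Sum>S\<in>insert b ` Pow B. sdet (I - S) f)" .
  moreover have "Pow B \<inter> insert b ` Pow B = {}"
    using insert.hyps by auto
  ultimately show ?case
    unfolding Pow_insert using insert.hyps(1) by (simp only: sum.union_disjoint finite_Pow_iff finite_imageI)
qed


section \<open>Kernels on the integers\<close>

lemma infsum_finite_support:
  fixes f :: "'a \<Rightarrow> real"
  assumes "finite S" "\<And>x. x \<notin> S \<Longrightarrow> f x = 0"
  shows "infsum f UNIV = sum f S"
proof -
  have "infsum f UNIV = infsum f S"
    using assms(2) by (intro infsum_cong_neutral) auto
  then show ?thesis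
    using assms(1) by simp
qed

definition lower_kernel :: "kernel \<Rightarrow> bool" where
  "lower_kernel A \<longleftrightarrow> (\<forall>x y. x < y \<longrightarrow> A x y = 0)"

lemma lower_kernel_kid: "lower_kernel kid"
  by (simp add: lower_kernel_def kid_def)

lemma lower_kernel_Qker: "lower_kernel (Qker q i)"
  by (simp add: lower_kernel_def Qker_def)

lemma kcomp_lower:
  assumes "lower_kernel A" "lower_kernel B" "a \<le> z" "x \<le> b"
  shows "kcomp A B x z = (\<Sum>y\<in>{a..b}. A x y * B y z)"
  unfolding kcomp_def
proof (rule infsum_finite_support)
  fix y assume "y \<notin> {a..b}"
  then have "y < z \<or> x < y" using assms(3,4) by auto
  then show "A x y * B y z = 0"
    using assms(1,2) by (auto simp: lower_kernel_def)
qed simp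

lemma lower_kernel_kcomp:
  assumes "lower_kernel A" "lower_kernel B"
  shows "lower_kernel (kcomp A B)"
  unfolding lower_kernel_def
proof (intro allI impI)
  fix x z :: int assume "x < z"
  have "kcomp A B x z = (\<Sum>y\<in>{z..x}. A x y * B y z)"
    using assms by (intro kcomp_lower) auto
  then show "kcomp A B x z = 0" using \<open>x < z\<close> by simp
qed

lemma kcomp_kid_right: "kcomp A kid = A"
proof (intro ext)
  fix x z
  have "kcomp A kid x z = (\<Sum>y\<in>{z}. A x y * kid y z)"
    unfolding kcomp_def by (rule infsum_finite_support) (auto simp: kid_def)
  then show "kcomp A kid x z = A x z" by (simp add: kid_def)
qed

lemma kcomp_kid_left: "kcomp kid A = A"
proof (intro ext)
  fix x z
  have "kcomp kid A x z = (\<Sum>y\<in>{x}. kid x y * A y z)"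
    unfolding kcomp_def by (rule infsum_finite_support) (auto simp: kid_def)
  then show "kcomp kid A x z = A x z" by (simp add: kid_def)
qed

text \<open>
  For kernels that only move downwards, the intermediate points of a composition lie between its two end
  points, so all sums are finite and may be interchanged.
\<close>
lemma kcomp_assoc_lower:
  assumes "lower_kernel A" "lower_kernel B" "lower_kernel C"
  shows "kcomp (kcomp A B) C = kcomp A (kcomp B C)"
proof (intro ext)
  fix x z
  have "kcomp (kcomp A B) C x z = (\<Sum>y\<in>{z..x}. kcomp A B x y * C y z)"
    using assms lower_kernel_kcomp by (intro kcomp_lower) auto
  also have "\<dots> = (\<Sum>y\<in>{z..x}. \<Sum>w\<in>{z..x}. A x w * B w y * C y z)"
    using assms by (intro sum.cong refl) (subst kcomp_lower[of A B z _ _ x], auto simp: sum_distrib_right)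
  also have "\<dots> = (\<Sum>w\<in>{z..x}. \<Sum>y\<in>{z..x}. A x w * B w y * C y z)"
    by (rule sum.swap)
  also have "\<dots> = (\<Sum>w\<in>{z..x}. A x w * kcomp B C w z)"
    using assms by (intro sum.cong refl) (subst kcomp_lower[of B C z _ _ x], auto simp: sum_distrib_left mult.assoc)
  also have "\<dots> = kcomp A (kcomp B C) x z"
    using assms lower_kernel_kcomp by (intro kcomp_lower[symmetric]) auto
  finally show "kcomp (kcomp A B) C x z = kcomp A (kcomp B C) x z" .
qed

lemma kprod_Nil [simp]: "kprod [] = kid"
  by (simp add: kprod_def)

lemma kprod_Cons [simp]: "kprod (A # As) = kcomp A (kprod As)"
  by (simp add: kprod_def)

lemma lower_kernel_kprod: "(\<And>A. A \<in> set As \<Longrightarrow> lower_kernel A) \<Longrightarrow> lower_kernel (kprod As)"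
  by (induction As) (auto intro: lower_kernel_kid lower_kernel_kcomp)

lemma kprod_snoc_lower:
  assumes "\<And>A. A \<in> set As \<Longrightarrow> lower_kernel A" "lower_kernel B"
  shows "kprod (As @ [B]) = kcomp (kprod As) B"
  using assms(1)
proof (induction As)
  case Nil
  then show ?case by (simp add: kcomp_kid_left kcomp_kid_right)
next
  case (Cons A As)
  then have "kprod ((A # As) @ [B]) = kcomp A (kcomp (kprod As) B)" by simp
  also have "\<dots> = kcomp (kcomp A (kprod As)) B"
    using Cons.prems assms(2) by (intro kcomp_assoc_lower[symmetric] lower_kernel_kprod) auto
  finally show ?case by simp
qed

lemma lower_kernel_Qprod: "lower_kernel (Qprod q m n)"
  unfolding Qprod_def by (rule lower_kernel_kprod) (auto simp: lower_kernel_Qker)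

lemma Qprod_same: "Qprod q m m = kid"
  by (simp add: Qprod_def)

text \<open>
  The definition of \<open>Qprod\<close> peels factors from the left, while the block inverse below needs the last factor. The
  summation range may be any interval that contains the two end points, in particular the window.
\<close>
lemma Qprod_Suc:
  assumes "m \<le> n" "a \<le> z" "x \<le> b"
  shows "Qprod q m (Suc n) x z = (\<Sum>y\<in>{a..b}. Qprod q m n x y * Qker q (Suc n) y z)"
proof -
  have "Qprod q m (Suc n) = kcomp (Qprod q m n) (Qker q (Suc n))"
    using assms(1) unfolding Qprod_def
    by (subst kprod_snoc_lower[symmetric]) (auto simp: lower_kernel_Qker)
  then show ?thesis
    using assms by (simp add: kcomp_lower lower_kernel_Qprod lower_kernel_Qker)
qed

definition banded :: "kernel \<Rightarrow> bool" where
  "banded A \<longleftrightarrow> (\<exists>b. \<forall>x y. A x y \<noteq> 0 \<longrightarrow> \<bar>x - y\<bar> \<le> b)"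

text \<open>
  The function \<open>w\<^sup>z\<close> is a left eigenfunction of a translation invariant kernel, and its eigenvalue is the
  symbol of the kernel at \<open>w\<close>; symbols multiply under composition.
\<close>
definition geometric_eigen :: "kernel \<Rightarrow> real \<Rightarrow> real \<Rightarrow> bool" where
  "geometric_eigen A w c \<longleftrightarrow> (\<forall>y. (\<Sum>\<^sub>\<infinity>z. w powi z * A z y) = c * w powi y)"

text \<open>
  Bandedness makes every sum finite, which justifies the interchange of summations behind the multiplication
  of eigenvalues.
\<close>
lemma banded_kcomp_eigen:
  assumes "banded A" "banded B"
  shows "banded (kcomp A B)"
    and "geometric_eigen A w c \<Longrightarrow> geometric_eigen B w d \<Longrightarrow> geometric_eigen (kcomp A B) w (c * d)"
proof -
  obtain a where a: "\<And>x y. A x y \<noteq> 0 \<Longrightarrow> \<bar>x - y\<bar> \<le> a"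
    using assms(1) by (auto simp: banded_def)
  obtain b where b: "\<And>x y. B x y \<noteq> 0 \<Longrightarrow> \<bar>x - y\<bar> \<le> b"
    using assms(2) by (auto simp: banded_def)
  have comp: "kcomp A B x z = (\<Sum>y\<in>{z - b..z + b}. A x y * B y z)" for x z
    unfolding kcomp_def
  proof (rule infsum_finite_support)
    fix y assume "y \<notin> {z - b..z + b}"
    then have "B y z = 0" using b[of y z] by fastforce
    then show "A x y * B y z = 0" by simp
  qed simp
  have supp: "kcomp A B x z = 0" if "\<not> \<bar>x - z\<bar> \<le> a + b" for x z
    unfolding comp
  proof (rule sum.neutral, rule ballI)
    fix y assume "y \<in> {z - b..z + b}"
    then have "\<not> \<bar>x - y\<bar> \<le> a" using that by auto
    then show "A x y * B y z = 0" using a[of x y] by auto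
  qed
  then show "banded (kcomp A B)"
    unfolding banded_def by blast
  assume A: "geometric_eigen A w c" and B: "geometric_eigen B w d"
  show "geometric_eigen (kcomp A B) w (c * d)"
    unfolding geometric_eigen_def
  proof
    fix x
    let ?S = "{x - (a + b)..x + (a + b)}" and ?T = "{x - b..x + b}"
    have "(\<Sum>\<^sub>\<infinity>z. w powi z * kcomp A B z x) = (\<Sum>z\<in>?S. w powi z * kcomp A B z x)"
    proof (rule infsum_finite_support)
      fix z assume "z \<notin> ?S"
      then have "\<not> \<bar>z - x\<bar> \<le> a + b" by auto
      then show "w powi z * kcomp A B z x = 0" using supp[of z x] by simp
    qed simp
    also have "\<dots> = (\<Sum>z\<in>?S. \<Sum>y\<in>?T. w powi z * A z y * B y x)"
      by (simp add: comp sum_distrib_left mult.assoc)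
    also have "\<dots> = (\<Sum>y\<in>?T. \<Sum>z\<in>?S. w powi z * A z y * B y x)"
      by (rule sum.swap)
    also have "\<dots> = (\<Sum>y\<in>?T. c * w powi y * B y x)"
    proof (rule sum.cong[OF refl])
      fix y assume y: "y \<in> ?T"
      have "(\<Sum>\<^sub>\<infinity>z. w powi z * A z y) = (\<Sum>z\<in>?S. w powi z * A z y)"
      proof (rule infsum_finite_support)
        fix z assume "z \<notin> ?S"
        then have "\<not> \<bar>z - y\<bar> \<le> a" using y by auto
        then show "w powi z * A z y = 0" using a[of z y] by auto
      qed simp
      then show "(\<Sum>z\<in>?S. w powi z * A z y * B y x) = c * w powi y * B y x"
        using A by (simp add: geometric_eigen_def flip: sum_distrib_right)
    qed
    also have "\<dots> = c * (\<Sum>y\<in>?T. w powi y * B y x)"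
      by (simp add: sum_distrib_left mult.assoc)
    also have "(\<Sum>y\<in>?T. w powi y * B y x) = (\<Sum>\<^sub>\<infinity>y. w powi y * B y x)"
    proof (rule infsum_finite_support[symmetric])
      fix y assume "y \<notin> ?T"
      then have "\<not> \<bar>y - x\<bar> \<le> b" by auto
      then show "w powi y * B y x = 0" using b[of y x] by auto
    qed simp
    also have "\<dots> = d * w powi x"
      using B by (simp add: geometric_eigen_def)
    finally show "(\<Sum>\<^sub>\<infinity>z. w powi z * kcomp A B z x) = c * d * w powi x" by simp
  qed
qed

lemma banded_kid: "banded kid"
  unfolding banded_def kid_def by (rule exI[of _ 0]) auto

lemma geometric_eigen_kid: "geometric_eigen kid w 1"
  unfolding geometric_eigen_def
proof
  fix y
  show "(\<Sum>\<^sub>\<infinity>z. w powi z * kid z y) = 1 * w powi y"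
    by (subst infsum_finite_support[of "{y}"]) (auto simp: kid_def)
qed

lemma banded_Rstar: "banded (Rstar p i)"
  unfolding banded_def Rstar_def Rker_def by (rule exI[of _ 1]) (auto split: if_splits)

lemma geometric_eigen_Rstar:
  assumes "w \<noteq> 0"
  shows "geometric_eigen (Rstar p i) w (1 + p i * w)"
  unfolding geometric_eigen_def
proof
  fix y
  have "(\<Sum>\<^sub>\<infinity>z. w powi z * Rstar p i z y) = (\<Sum>z\<in>{y, y + 1}. w powi z * Rstar p i z y)"
    by (rule infsum_finite_support) (auto simp: Rstar_def Rker_def)
  also have "\<dots> = (1 + p i * w) * w powi y"
    using assms by (simp add: Rstar_def Rker_def power_int_add algebra_simps)
  finally show "(\<Sum>\<^sub>\<infinity>z. w powi z * Rstar p i z y) = (1 + p i * w) * w powi y" .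
qed

lemma banded_Qinv: "banded (Qinv q i)"
  unfolding banded_def Qinv_def by (rule exI[of _ 1]) (auto split: if_splits)

lemma geometric_eigen_Qinv:
  assumes "w \<noteq> 0"
  shows "geometric_eigen (Qinv q i) w ((q i - w) / w)"
  unfolding geometric_eigen_def
proof
  fix y
  have "(\<Sum>\<^sub>\<infinity>z. w powi z * Qinv q i z y) = (\<Sum>z\<in>{y, y - 1}. w powi z * Qinv q i z y)"
    by (rule infsum_finite_support) (auto simp: Qinv_def)
  also have "\<dots> = (q i - w) / w * w powi y"
    using assms by (simp add: Qinv_def power_int_diff field_simps)
  finally show "(\<Sum>\<^sub>\<infinity>z. w powi z * Qinv q i z y) = (q i - w) / w * w powi y" .
qed

lemma kprod_map_eigen:
  assumes "\<And>i. banded (A i)" "\<And>i. geometric_eigen (A i) w (c i)"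
  shows "banded (kprod (map A is)) \<and> geometric_eigen (kprod (map A is)) w (prod_list (map c is))"
  using assms by (induction "is") (auto intro: banded_kid geometric_eigen_kid banded_kcomp_eigen)

lemma PsiN_kernel_eigen:
  assumes "w \<noteq> 0"
  shows "banded (kcomp (Rstar_prod p r t) (Qinv_prod q k N))"
    and "geometric_eigen (kcomp (Rstar_prod p r t) (Qinv_prod q k N)) w
      ((\<Prod>i = r + 1..t. 1 + p i * w) * (\<Prod>l = k + 1..N. (q l - w) / w))"
proof -
  have prod: "prod_list (map c (rev [a + 1..<b + 1])) = (\<Prod>i = a + 1..b. c i)" for c :: "nat \<Rightarrow> real" and a b
  proof -
    have "set (rev [a + 1..<b + 1]) = {a + 1..b}" by auto
    then show ?thesis
      using prod.distinct_set_conv_list[of "rev [a + 1..<b + 1]" c] by simp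
  qed
  have R: "banded (Rstar_prod p r t)" "geometric_eigen (Rstar_prod p r t) w (\<Prod>i = r + 1..t. 1 + p i * w)"
    using kprod_map_eigen[of "Rstar p" w "\<lambda>i. 1 + p i * w" "rev [r + 1..<t + 1]"]
      banded_Rstar geometric_eigen_Rstar[OF assms] unfolding Rstar_prod_def prod by auto
  have Q: "banded (Qinv_prod q k N)" "geometric_eigen (Qinv_prod q k N) w (\<Prod>l = k + 1..N. (q l - w) / w)"
    using kprod_map_eigen[of "Qinv q" w "\<lambda>l. (q l - w) / w" "rev [k + 1..<N + 1]"]
      banded_Qinv geometric_eigen_Qinv[OF assms] unfolding Qinv_prod_def prod by auto
  show "banded (kcomp (Rstar_prod p r t) (Qinv_prod q k N))"
    using R Q by (intro banded_kcomp_eigen)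
  show "geometric_eigen (kcomp (Rstar_prod p r t) (Qinv_prod q k N)) w
      ((\<Prod>i = r + 1..t. 1 + p i * w) * (\<Prod>l = k + 1..N. (q l - w) / w))"
    using R Q by (intro banded_kcomp_eigen)
qed

text \<open>
  \<open>\<Psi>\<^sub>k\<close> is a column of the composed kernel, so its pairing with \<open>w\<^sup>z\<close> is the eigenvalue times \<open>w\<close> to the
  index of that column.
\<close>
lemma PsiN_generating_function:
  assumes "w \<noteq> 0"
  shows "(\<Sum>\<^sub>\<infinity>z. w powi z * PsiN N q p r t y k z) =
    (\<Prod>i = r + 1..t. 1 + p i * w) * (\<Prod>l = k + 1..N. (q l - w) / w) * w powi (y k - int k)"
  using PsiN_kernel_eigen(2)[OF assms] by (simp add: PsiN_def geometric_eigen_def)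

lemma PsiN_finite_support:
  obtains lo hi where "\<And>k x. k \<in> {1..N} \<Longrightarrow> PsiN N q p r t y k x \<noteq> 0 \<Longrightarrow> lo \<le> x \<and> x \<le> hi"
proof -
  have "\<exists>b. \<forall>x. PsiN N q p r t y k x \<noteq> 0 \<longrightarrow> \<bar>x\<bar> \<le> b" for k
  proof -
    obtain b where b: "\<And>x z. kcomp (Rstar_prod p r t) (Qinv_prod q k N) x z \<noteq> 0 \<Longrightarrow> \<bar>x - z\<bar> \<le> b"
      using PsiN_kernel_eigen(1)[of 1 p r t q k N] unfolding banded_def by auto
    show ?thesis
      using b[of _ "y k - int k"] unfolding PsiN_def
      by (intro exI[of _ "b + \<bar>y k - int k\<bar>"]) fastforce
  qed
  then obtain b where b: "\<And>k x. PsiN N q p r t y k x \<noteq> 0 \<Longrightarrow> \<bar>x\<bar> \<le> b k"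
    by metis
  define c where "c = (\<Sum>k = 1..N. \<bar>b k\<bar>)"
  have "b k \<le> c" if "k \<in> {1..N}" for k
    using member_le_sum[of k "{1..N}" "\<lambda>k. \<bar>b k\<bar>"] that by (auto simp: c_def)
  then show ?thesis
    using b by (intro that[of "- c" c]) fastforce
qed

text \<open>
  Composing with the inverse kernel \<open>Qinv q n\<close> on the right lowers the upper end of the range by one.
\<close>
lemma Qvirt_range_recurrence:
  assumes "q j \<noteq> 0" "j < n \<Longrightarrow> q n \<noteq> q j" "1 \<le> n"
  shows "q n * Qvirt_range q j n (x - 1) = Qvirt_range q j n x + Qvirt_range q j (n - 1) x"
proof -
  consider "n < j" | "j = n" | "j < n" by linarith
  then show ?thesis
  proof cases
    case 1
    then show ?thesis by (simp add: Qvirt_range_def)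
  next
    case 2
    have "q j powi x = q j * q j powi (x - 1)"
      using assms by (simp add: power_int_diff)
    then show ?thesis using 2 assms(3) by (simp add: Qvirt_range_def)
  next
    case 3
    then obtain m where n: "n = Suc m" "j \<le> m" by (cases n) auto
    let ?D = "\<Prod>l = j + 1..m. q l - q j"
    have D: "(\<Prod>l = j + 1..n. q l - q j) = ?D * (q n - q j)"
      using n by (simp add: prod.nat_ivl_Suc')
    define E where "E = q j powi (x - 1 + int n - int j)"
    have "q j powi (x + int n - int j) = q j powi ((x - 1 + int n - int j) + 1)"
      by (simp add: algebra_simps)
    also have "\<dots> = E * q j"
      unfolding E_def using assms(1) by (subst power_int_add) simp_all
    finally have E1: "q j powi (x + int n - int j) = E * q j" .
    have E2: "q j powi (x + int (n - 1) - int j) = E"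
      using n by (simp add: E_def algebra_simps)
    have "q n * (E / (?D * (q n - q j))) = E * q j / (?D * (q n - q j)) + E / ?D"
      using assms(2)[OF 3] by (simp add: divide_simps) (simp add: algebra_simps)
    moreover have "n - 1 = m" using n by simp
    ultimately show ?thesis
      using 3 n unfolding Qvirt_range_def D E1 E2 E_def[symmetric] by simp
  qed
qed

text \<open>
  For \<open>j < n\<close>, composition with \<open>Q\<^sub>n\<close> would reproduce \<open>Qvirt_range q j n\<close> if the sum ran to infinity. Cut off at \<open>hi\<close>, it
  misses the tail of a geometric series, and this tail depends on \<open>x\<close> only through \<open>q\<^sub>n\<^sup>x\<close>. The coefficient
  is read off at \<open>x = hi\<close>, where the sum is empty; for \<open>j = n\<close> it is \<open>1\<close>, and for \<open>j > n\<close> it is \<open>0\<close>.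
\<close>
lemma Qvirt_range_window:
  assumes "q j \<noteq> 0" "q n \<noteq> 0" "j < n \<Longrightarrow> q n \<noteq> q j" "1 \<le> n" "x \<in> {lo..hi}"
  shows "Qvirt_range q j n x - (\<Sum>z\<in>{lo..hi}. Qvirt_range q j (n - 1) z * Qker q n z x)
    = Qvirt_range q j n hi * q n powi (- hi) * q n powi x"
proof -
  let ?s = "\<lambda>x. \<Sum>z\<in>{x + 1..hi}. Qvirt_range q j (n - 1) z * q n powi (x - z)"
  have "Qvirt_range q j n x - ?s x = Qvirt_range q j n hi * q n powi (- hi) * q n powi x"
    if "x \<le> hi" for x
    using that
  proof (induction x rule: int_le_induct)
    case base
    then show ?case using assms(2) by (simp add: power_int_minus)
  next
    case (step x)
    have "{x - 1 + 1..hi} = insert x {x + 1..hi}"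
      using step.hyps by auto
    then have "?s (x - 1) = Qvirt_range q j (n - 1) x * q n powi (- 1)
        + (\<Sum>z\<in>{x + 1..hi}. Qvirt_range q j (n - 1) z * q n powi (x - 1 - z))"
      by simp
    also have "(\<Sum>z\<in>{x + 1..hi}. Qvirt_range q j (n - 1) z * q n powi (x - 1 - z)) = ?s x / q n"
    proof -
      have "q n powi (x - 1 - z) = q n powi (x - z) / q n" for z
        using assms(2) power_int_diff[of "q n" "x - z" 1] by (simp add: algebra_simps)
      then show ?thesis by (simp add: sum_divide_distrib)
    qed
    finally have "q n * (Qvirt_range q j n (x - 1) - ?s (x - 1)) =
        q n * Qvirt_range q j n (x - 1) - Qvirt_range q j (n - 1) x - ?s x"
      using assms(2) by (simp add: power_int_minus field_simps)
    also have "\<dots> = Qvirt_range q j n x - ?s x"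
      using Qvirt_range_recurrence[of q j n x] assms by simp
    also have "\<dots> = Qvirt_range q j n hi * q n powi (- hi) * q n powi x"
      by (rule step.IH)
    also have "\<dots> = q n * (Qvirt_range q j n hi * q n powi (- hi) * q n powi (x - 1))"
      using assms(2) by (simp add: power_int_diff)
    finally show ?case
      using assms(2) by (simp only: mult_cancel_left) simp
  qed
  moreover have "(\<Sum>z\<in>{lo..hi}. Qvirt_range q j (n - 1) z * Qker q n z x) = ?s x"
    using assms(5) by (intro sum.mono_neutral_cong_right) (auto simp: Qker_def)
  ultimately show ?thesis
    using assms(5) by simp
qed


section \<open>The L-ensemble matrix and its inverse\<close>

text \<open>
  The virtual point \<open>k\<close> is the pair \<open>(0, k)\<close>; level \<open>0\<close> carries no particles, so virtual points and particles can
  share one index type.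
\<close>
definition virtuals :: "nat \<Rightarrow> (nat \<times> int) set" where
  "virtuals N = (\<lambda>k. (0, int k)) ` {1..N}"

definition window :: "nat \<Rightarrow> int \<Rightarrow> int \<Rightarrow> (nat \<times> int) set" where
  "window N lo hi = {1..N} \<times> {lo..hi}"

lemma finite_virtuals: "finite (virtuals N)"
  by (simp add: virtuals_def)

lemma finite_window: "finite (window N lo hi)"
  by (simp add: window_def)

lemma virtuals_window_disjoint: "virtuals N \<inter> window N lo hi = {}"
  by (auto simp: virtuals_def window_def)

lemma sum_virtuals_window:
  fixes h :: "nat \<times> int \<Rightarrow> real"
  shows "(\<Sum>v\<in>virtuals N \<union> window N lo hi. h v) =
    (\<Sum>k = 1..N. h (0, int k)) + (\<Sum>n = 1..N. \<Sum>z\<in>{lo..hi}. h (n, z))"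
proof -
  have "(\<Sum>v\<in>virtuals N. h v) = (\<Sum>k = 1..N. h (0, int k))"
    unfolding virtuals_def by (subst sum.reindex) (auto simp: inj_on_def)
  moreover have "(\<Sum>v\<in>window N lo hi. h v) = (\<Sum>n = 1..N. \<Sum>z\<in>{lo..hi}. h (n, z))"
    unfolding window_def by (simp add: sum.cartesian_product)
  ultimately show ?thesis
    by (subst sum.union_disjoint[OF finite_virtuals finite_window virtuals_window_disjoint]) simp
qed

locale interlacing_data =
  fixes N r t :: nat and p q :: "nat \<Rightarrow> real" and y :: "nat \<Rightarrow> int"
  assumes q_pos: "\<And>i. i \<in> {1..N} \<Longrightarrow> 0 < q i"
    and q_less: "\<And>i j. 1 \<le> i \<Longrightarrow> i < j \<Longrightarrow> j \<le> N \<Longrightarrow> q i < q j"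
    and p_pos: "\<And>i. 1 \<le> i \<Longrightarrow> 0 < p i"
begin

abbreviation "Mij i j \<equiv> Mmat N q p r t y $$ (i - 1, j - 1)"
abbreviation "Minv i j \<equiv> the (mat_inverse (Mmat N q p r t y)) $$ (i - 1, j - 1)"
abbreviation "PsiTop k x \<equiv> PsiN N q p r t y k x"
abbreviation "PsiLev n k x \<equiv> Psi N q p r t y n k x"
abbreviation "K \<equiv> corr_kernel N q p r t y"

lemma Mij_eq_sum:
  assumes "i \<in> {1..N}" "j \<in> {1..N}"
  shows "Mij i j = (\<Sum>\<^sub>\<infinity>z. Qvirt_range q i N z * PsiTop j z)"
  using assms by (auto simp: Mmat_def mat_of1_def)

lemma Mij_formula:
  assumes "i \<in> {1..N}" "j \<in> {1..N}"
  shows "Mij i j = q i powi (int N - int i) / (\<Prod>l = i + 1..N. q l - q i) *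
    ((\<Prod>l = r + 1..t. 1 + p l * q i) * (\<Prod>l = j + 1..N. (q l - q i) / q i) * q i powi (y j - int j))"
proof -
  have q0: "q i \<noteq> 0" using q_pos[OF assms(1)] by simp
  have "Mij i j = (\<Sum>\<^sub>\<infinity>z. q i powi (int N - int i) / (\<Prod>l = i + 1..N. q l - q i) * (q i powi z * PsiTop j z))"
    unfolding Mij_eq_sum[OF assms]
  proof (rule infsum_cong)
    fix z
    have "z + int N - int i = z + (int N - int i)" by simp
    then have "q i powi (z + int N - int i) = q i powi z * q i powi (int N - int i)"
      by (simp only: power_int_add q0 simp_thms)
    then show "Qvirt_range q i N z * PsiTop j z =
        q i powi (int N - int i) / (\<Prod>l = i + 1..N. q l - q i) * (q i powi z * PsiTop j z)"
      using assms by (simp add: Qvirt_range_def)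
  qed
  also have "\<dots> = q i powi (int N - int i) / (\<Prod>l = i + 1..N. q l - q i) * (\<Sum>\<^sub>\<infinity>z. q i powi z * PsiTop j z)"
    by (rule infsum_cmult_right')
  finally show ?thesis
    unfolding PsiN_generating_function[OF q0] .
qed

text \<open>
  The generating function of \<open>\<Psi>\<^sub>j\<close> at \<open>q\<^sub>i\<close> contains the factor \<open>q\<^sub>i - q\<^sub>i\<close>.
\<close>
lemma Mij_below_diagonal:
  assumes "i \<in> {1..N}" "j \<in> {1..N}" "j < i"
  shows "Mij i j = 0"
proof -
  have "(\<Prod>l = j + 1..N. (q l - q i) / q i) = 0"
    using assms by (intro prod_zero bexI[of _ i]) auto
  then show ?thesis using Mij_formula[OF assms(1,2)] by simp
qed

text \<open>
  The denominators of \<open>Qvirt_range q i N\<close> cancel the factors \<open>q\<^sub>l - q\<^sub>i\<close> coming from the inverse kernels.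
\<close>
lemma Mij_diagonal:
  assumes "i \<in> {1..N}"
  shows "Mij i i = (\<Prod>l = r + 1..t. 1 + p l * q i) * q i powi (y i - int i)"
proof -
  have q0: "q i \<noteq> 0" using q_pos[OF assms] by simp
  have D: "(\<Prod>l = i + 1..N. q l - q i) \<noteq> 0"
  proof -
    have "q l - q i \<noteq> 0" if "l \<in> {i + 1..N}" for l
      using q_less[of i l] assms that by auto
    then show ?thesis by simp
  qed
  have "(\<Prod>l = i + 1..N. (q l - q i) / q i) = (\<Prod>l = i + 1..N. q l - q i) / q i powi (int N - int i)"
  proof -
    have "i \<le> N" using assms by simp
    then have "int N - int i = int (N - i)" by (rule of_nat_diff[symmetric])
    then have "q i powi (int N - int i) = q i ^ (N - i)"
      by (simp only: power_int_of_nat)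
    then show ?thesis by (simp add: prod_dividef)
  qed
  moreover have "a / d * (b * (d / a) * c) = b * c" if "a \<noteq> 0" "d \<noteq> 0" for a b c d :: real
    using that by simp
  ultimately show ?thesis
    unfolding Mij_formula[OF assms assms] using D q0 by simp
qed

lemma Mij_diagonal_nonzero:
  assumes "i \<in> {1..N}"
  shows "Mij i i \<noteq> 0"
proof -
  have "1 + p l * q i > 0" if "l \<in> {r + 1..t}" for l
    using q_pos[OF assms] p_pos[of l] that by (simp add: add_pos_pos)
  then have "1 + p l * q i \<noteq> 0" if "l \<in> {r + 1..t}" for l
    using that by force
  then show ?thesis
    unfolding Mij_diagonal[OF assms] using q_pos[OF assms] by simp
qed

lemma Mmat_carrier: "Mmat N q p r t y \<in> carrier_mat N N"
  by (simp add: Mmat_def mat_of1_def)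

lemma Mmat_upper_triangular: "upper_triangular (Mmat N q p r t y)"
  unfolding upper_triangular_def
proof (intro allI impI)
  fix i j assume "i < dim_row (Mmat N q p r t y)" "j < i"
  then show "Mmat N q p r t y $$ (i, j) = 0"
    using Mij_below_diagonal[of "i + 1" "j + 1"] Mmat_carrier by auto
qed

lemma det_Mmat: "det (Mmat N q p r t y) = (\<Prod>k = 1..N. Mij k k)"
proof -
  have "det (Mmat N q p r t y) = prod_list (diag_mat (Mmat N q p r t y))"
    by (rule det_upper_triangular[OF Mmat_upper_triangular Mmat_carrier])
  also have "\<dots> = (\<Prod>k = 0..<N. Mmat N q p r t y $$ (k, k))"
    using Mmat_carrier by (simp add: prod_list_diag_prod)
  also have "\<dots> = (\<Prod>k = 1..N. Mij k k)"
    by (rule prod.reindex_bij_witness[of _ "\<lambda>k. k - 1" Suc]) auto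
  finally show ?thesis .
qed

lemma Mmat_inverse:
  obtains B where "mat_inverse (Mmat N q p r t y) = Some B" "Mmat N q p r t y * B = 1\<^sub>m N"
    "B * Mmat N q p r t y = 1\<^sub>m N" "B \<in> carrier_mat N N"
proof (cases "mat_inverse (Mmat N q p r t y)")
  case None
  have "det (Mmat N q p r t y) \<noteq> 0"
    unfolding det_Mmat using Mij_diagonal_nonzero by simp
  then have "Mmat N q p r t y \<in> Units (ring_mat TYPE(real) N ())"
    using det_non_zero_imp_unit[OF Mmat_carrier, where b = "()"] by blast
  then show ?thesis
    using mat_inverse(1)[OF Mmat_carrier None, where b = "()"] by blast
next
  case (Some B)
  then show ?thesis
    using mat_inverse(2)[OF Mmat_carrier Some] that by blast
qed

lemma Mmat_invertible: "invertible_mat (Mmat N q p r t y)"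
proof -
  obtain B where B: "mat_inverse (Mmat N q p r t y) = Some B" "Mmat N q p r t y * B = 1\<^sub>m N"
    "B * Mmat N q p r t y = 1\<^sub>m N" "B \<in> carrier_mat N N"
    by (rule Mmat_inverse)
  then show ?thesis
    using Mmat_carrier unfolding invertible_mat_def inverts_mat_def
    by (auto intro!: exI[of _ B])
qed

lemma Minv_Mij:
  assumes "i \<in> {1..N}" "l \<in> {1..N}"
  shows "(\<Sum>j = 1..N. Minv i j * Mij j l) = of_bool (i = l)"
proof -
  obtain B where B: "mat_inverse (Mmat N q p r t y) = Some B" "Mmat N q p r t y * B = 1\<^sub>m N"
    "B * Mmat N q p r t y = 1\<^sub>m N" "B \<in> carrier_mat N N"
    by (rule Mmat_inverse)
  have "(\<Sum>j = 1..N. Minv i j * Mij j l) = (\<Sum>j = 0..<N. B $$ (i - 1, j) * Mmat N q p r t y $$ (j, l - 1))"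
    by (rule sum.reindex_bij_witness[of _ Suc "\<lambda>k. k - 1"]) (auto simp: B(1))
  also have "\<dots> = (B * Mmat N q p r t y) $$ (i - 1, l - 1)"
    using B(4) Mmat_carrier assms by (auto simp: scalar_prod_def)
  also have "\<dots> = of_bool (i = l)"
    unfolding B(3) using assms by auto
  finally show ?thesis .
qed

text \<open>
  The matrix \<open>L\<close> of the L-ensemble. The sign in front of \<open>Q\<close> makes the particle block of \<open>1 + L\<close> equal to
  \<open>1 - W\<close> with \<open>W\<close> made of the kernels \<open>Q\<^sub>m\<close>, so that its inverse is a sum of products of these kernels.
\<close>
definition Lmat :: "nat \<times> int \<Rightarrow> nat \<times> int \<Rightarrow> real" where
  "Lmat u v =
    (if fst u = 0 then (if fst v = 0 then 0 else of_bool (snd u = int (fst v)) * Qvirt q (fst v) (snd v))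
     else if fst v = 0 then of_bool (fst u = N) * PsiTop (nat (snd v)) (snd u)
     else - of_bool (fst v = Suc (fst u)) * Qker q (fst v) (snd u) (snd v))"

end

text \<open>
  Any window containing the supports is admitted, so that it can be enlarged to contain a given set of points.
\<close>
locale window_data = interlacing_data +
  fixes lo hi :: int
  assumes support: "\<And>k x. k \<in> {1..N} \<Longrightarrow> PsiN N q p r t y k x \<noteq> 0 \<Longrightarrow> lo \<le> x \<and> x \<le> hi"
begin

abbreviation "V \<equiv> virtuals N"
abbreviation "W \<equiv> window N lo hi"

text \<open>
  \<open>1\<close> is added on the window only: virtual points are forced to be present, points of the window are free.
\<close>
definition Amat :: "nat \<times> int \<Rightarrow> nat \<times> int \<Rightarrow> real" where
  "Amat u v = Lmat u v + of_bool (u = v \<and> u \<in> W)"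

lemma Amat_column_virtual:
  assumes "l \<in> {1..N}"
  shows "(\<Sum>v\<in>V \<union> W. b v * Amat v (0, int l)) = (\<Sum>z\<in>{lo..hi}. b (N, z) * PsiTop l z)"
proof -
  have "(\<Sum>z\<in>{lo..hi}. b (n, z) * Amat (n, z) (0, int l)) =
      (if n = N then \<Sum>z\<in>{lo..hi}. b (n, z) * PsiTop l z else 0)" if "n \<in> {1..N}" for n
    using that by (auto simp: Amat_def Lmat_def window_def)
  then have "(\<Sum>v\<in>V \<union> W. b v * Amat v (0, int l)) =
      (\<Sum>n = 1..N. if n = N then \<Sum>z\<in>{lo..hi}. b (n, z) * PsiTop l z else 0)"
    unfolding sum_virtuals_window by (simp add: Amat_def Lmat_def window_def)
  then show ?thesis using assms by simp
qed

lemma Amat_column_level: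
  assumes "n \<in> {1..N}" "x \<in> {lo..hi}"
  shows "(\<Sum>v\<in>V \<union> W. b v * Amat v (n, x)) =
    b (0, int n) * q n powi x + b (n, x)
      - of_bool (n \<ge> 2) * (\<Sum>z\<in>{lo..hi}. b (n - 1, z) * Qker q n z x)"
proof -
  have "(\<Sum>k = 1..N. b (0, int k) * Amat (0, int k) (n, x)) =
      (\<Sum>k = 1..N. if k = n then b (0, int n) * q n powi x else 0)"
    using assms by (intro sum.cong) (auto simp: Amat_def Lmat_def window_def Qvirt_def)
  also have "\<dots> = b (0, int n) * q n powi x"
    using assms(1) by simp
  finally have 1: "(\<Sum>k = 1..N. b (0, int k) * Amat (0, int k) (n, x)) = b (0, int n) * q n powi x" .
  have "(\<Sum>m = 1..N. \<Sum>z\<in>{lo..hi}. b (m, z) * Amat (m, z) (n, x)) =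
      (\<Sum>m = 1..N. (if m = n then \<Sum>z\<in>{lo..hi}. if z = x then b (n, x) else 0 else 0)
        - (if m = n - 1 then \<Sum>z\<in>{lo..hi}. b (n - 1, z) * Qker q n z x else 0))"
  proof (rule sum.cong[OF refl])
    fix m assume m: "m \<in> {1..N}"
    have "(\<Sum>z\<in>{lo..hi}. b (m, z) * Amat (m, z) (n, x)) =
        (\<Sum>z\<in>{lo..hi}. (if m = n \<and> z = x then b (n, x) else 0)
          - (if m = n - 1 then b (n - 1, z) * Qker q n z x else 0))"
      using m assms by (intro sum.cong refl) (auto simp: Amat_def Lmat_def window_def)
    also have "\<dots> = (\<Sum>z\<in>{lo..hi}. if m = n \<and> z = x then b (n, x) else 0)
        - (\<Sum>z\<in>{lo..hi}. if m = n - 1 then b (n - 1, z) * Qker q n z x else 0)"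
      by (rule sum_subtractf)
    finally show "(\<Sum>z\<in>{lo..hi}. b (m, z) * Amat (m, z) (n, x)) =
        (if m = n then \<Sum>z\<in>{lo..hi}. if z = x then b (n, x) else 0 else 0)
        - (if m = n - 1 then \<Sum>z\<in>{lo..hi}. b (n - 1, z) * Qker q n z x else 0)"
      by simp
  qed
  also have "\<dots> = b (n, x) - of_bool (n \<ge> 2) * (\<Sum>z\<in>{lo..hi}. b (n - 1, z) * Qker q n z x)"
  proof -
    have "n - 1 \<in> {1..N} \<longleftrightarrow> n \<ge> 2" using assms(1) by auto
    then show ?thesis
      using assms by (simp add: sum_subtractf)
  qed
  finally show ?thesis
    unfolding sum_virtuals_window 1 by simp
qed

text \<open>
  The row \<open>(- T, \<phi>)\<close>, where \<open>\<phi>\<close> stands for the untruncated functions \<open>Qvirt_range q j n\<close> and \<open>T\<close> collects the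
  coefficients of the truncated tails. It annihilates the columns of \<open>A\<close> in the window and pairs with
  the virtual columns to \<open>M\<close>.
\<close>
definition phi_row :: "nat \<Rightarrow> nat \<times> int \<Rightarrow> real" where
  "phi_row j v =
    (if fst v = 0 then - (Qvirt_range q j (nat (snd v)) hi * q (nat (snd v)) powi (- hi))
     else Qvirt_range q j (fst v) (snd v))"

text \<open>
  This is where the truncation at \<open>hi\<close> is absorbed: the tail is a multiple of the virtual row of level \<open>n\<close>.
\<close>
lemma phi_row_Amat_level:
  assumes "j \<in> {1..N}" "v \<in> W"
  shows "(\<Sum>u\<in>V \<union> W. phi_row j u * Amat u v) = 0"
proof -
  obtain n x where v: "v = (n, x)" "n \<in> {1..N}" "x \<in> {lo..hi}"
    using assms(2) by (auto simp: window_def)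
  have q: "q j \<noteq> 0" "q n \<noteq> 0" "j < n \<Longrightarrow> q n \<noteq> q j"
    using q_pos[OF assms(1)] q_pos[OF v(2)] q_less[of j n] assms(1) v(2) by auto
  have "(\<Sum>u\<in>V \<union> W. phi_row j u * Amat u v) =
     phi_row j (0, int n) * q n powi x + phi_row j (n, x)
      - of_bool (n \<ge> 2) * (\<Sum>z\<in>{lo..hi}. phi_row j (n - 1, z) * Qker q n z x)"
    unfolding v(1) by (rule Amat_column_level[OF v(2,3)])
  also have "of_bool (n \<ge> 2) * (\<Sum>z\<in>{lo..hi}. phi_row j (n - 1, z) * Qker q n z x) =
      (\<Sum>z\<in>{lo..hi}. Qvirt_range q j (n - 1) z * Qker q n z x)"
  proof (cases "n \<ge> 2")
    case True
    then show ?thesis by (simp add: phi_row_def)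
  next
    case False
    then have "n = 1" using v(2) by auto
    then show ?thesis using assms(1) by (simp add: Qvirt_range_def)
  qed
  finally show ?thesis
    using Qvirt_range_window[OF q _ v(3)] v(2) by (simp add: phi_row_def)
qed

lemma phi_row_Amat_virtual:
  assumes "j \<in> {1..N}" "l \<in> {1..N}"
  shows "(\<Sum>u\<in>V \<union> W. phi_row j u * Amat u (0, int l)) = Mij j l"
proof -
  have "Mij j l = (\<Sum>z\<in>{lo..hi}. Qvirt_range q j N z * PsiTop l z)"
    unfolding Mij_eq_sum[OF assms]
    using support[OF assms(2)] by (intro infsum_finite_support) auto
  then show ?thesis
    using Amat_column_virtual[OF assms(2), of "phi_row j"] assms(2) by (simp add: phi_row_def)
qed

text \<open>
  Rows of the inverse of \<open>1 - W\<close>, extended by \<open>0\<close> to the virtual points.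
\<close>
definition green_row :: "nat \<times> int \<Rightarrow> nat \<times> int \<Rightarrow> real" where
  "green_row u v = (if fst v = 0 then 0 else of_bool (fst u \<le> fst v) * Qprod q (fst u) (fst v) (snd u) (snd v))"

lemma green_row_Amat_level:
  assumes "u \<in> W" "v \<in> W"
  shows "(\<Sum>w\<in>V \<union> W. green_row u w * Amat w v) = of_bool (u = v)"
proof -
  obtain m x where u: "u = (m, x)" "m \<in> {1..N}" "x \<in> {lo..hi}"
    using assms(1) by (auto simp: window_def)
  obtain n z where v: "v = (n, z)" "n \<in> {1..N}" "z \<in> {lo..hi}"
    using assms(2) by (auto simp: window_def)
  have "(\<Sum>w\<in>V \<union> W. green_row u w * Amat w v) = green_row u v
      - of_bool (n \<ge> 2) * (\<Sum>w\<in>{lo..hi}. green_row u (n - 1, w) * Qker q n w z)"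
    unfolding v(1) Amat_column_level[OF v(2,3)] by (simp add: green_row_def)
  also have "\<dots> = of_bool (u = v)"
  proof -
    consider "n < m" | "n = m" | "m < n" by linarith
    then show ?thesis
    proof cases
      case 1
      then show ?thesis by (simp add: u(1) v(1) green_row_def)
    next
      case 2
      then show ?thesis using u(2) by (auto simp: u(1) v(1) green_row_def Qprod_same kid_def)
    next
      case 3
      then obtain n' where n': "n = Suc n'" "m \<le> n'" by (cases n) auto
      have "Qprod q m (Suc n') x z = (\<Sum>w\<in>{lo..hi}. Qprod q m n' x w * Qker q (Suc n') w z)"
        using u v n' by (intro Qprod_Suc) auto
      then show ?thesis
        using u(2) n' by (simp add: u(1) v(1) green_row_def)
    qed
  qed
  finally show ?thesis .
qed

text \<open>
  Compositions of the \<open>Q\<close> move downwards and the top-level functions are supported in the window, so no term is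
  lost to the restriction to the window.
\<close>
lemma green_row_Amat_virtual:
  assumes "u \<in> W" "l \<in> {1..N}"
  shows "(\<Sum>w\<in>V \<union> W. green_row u w * Amat w (0, int l)) = PsiLev (fst u) l (snd u)"
proof -
  obtain m x where u: "u = (m, x)" "m \<in> {1..N}" "x \<in> {lo..hi}"
    using assms(1) by (auto simp: window_def)
  have *: "(\<Sum>w\<in>V \<union> W. green_row u w * Amat w (0, int l)) = (\<Sum>z\<in>{lo..hi}. Qprod q m N x z * PsiTop l z)"
    unfolding Amat_column_virtual[OF assms(2)] using u by (auto simp: green_row_def)
  show ?thesis
  proof (cases "m < N")
    case True
    have "PsiLev m l x = (\<Sum>z\<in>{lo..hi}. Qprod q m N x z * PsiTop l z)"
      using True support[OF assms(2)] unfolding Psi_def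
      by (simp, intro infsum_finite_support) auto
    then show ?thesis using * u(1) by simp
  next
    case False
    then have "m = N" using u(2) by auto
    then have "(\<Sum>z\<in>{lo..hi}. Qprod q m N x z * PsiTop l z) = (\<Sum>z\<in>{lo..hi}. if z = x then PsiTop l x else 0)"
      by (intro sum.cong) (auto simp: Qprod_same kid_def)
    then show ?thesis using * u \<open>m = N\<close> by (simp add: Psi_def)
  qed
qed

text \<open>
  Block inversion of \<open>A\<close> by means of the rows \<open>phi_row\<close> and \<open>green_row\<close>. The rows at virtual points are
  the inverse of \<open>M\<close> times \<open>phi_row\<close>; those in the window subtract from \<open>green_row\<close> the combination that kills its pairing
  with the virtual columns.
\<close>
definition Bmat :: "nat \<times> int \<Rightarrow> nat \<times> int \<Rightarrow> real" where
  "Bmat u v =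
    (if fst u = 0 then \<Sum>j = 1..N. Minv (nat (snd u)) j * phi_row j v
     else green_row u v - (\<Sum>i = 1..N. \<Sum>j = 1..N. PsiLev (fst u) i (snd u) * Minv i j * phi_row j v))"

text \<open>
  \<open>Bmat\<close> is linear in \<open>phi_row\<close> and \<open>green_row\<close>, whose products with \<open>A\<close> are known; the virtual columns
  come out right because the inverse of \<open>M\<close> meets \<open>M\<close>.
\<close>
lemma Bmat_left_inverse:
  assumes "u \<in> V \<union> W" "v \<in> V \<union> W"
  shows "(\<Sum>w\<in>V \<union> W. Bmat u w * Amat w v) = of_bool (u = v)"
proof -
  let ?a = "\<lambda>j. \<Sum>w\<in>V \<union> W. phi_row j w * Amat w v"
  have lin: "(\<Sum>w\<in>V \<union> W. (\<Sum>j = 1..N. c j * phi_row j w) * Amat w v) = (\<Sum>j = 1..N. c j * ?a j)" for c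
  proof -
    have "(\<Sum>w\<in>V \<union> W. (\<Sum>j = 1..N. c j * phi_row j w) * Amat w v) =
        (\<Sum>w\<in>V \<union> W. \<Sum>j = 1..N. c j * (phi_row j w * Amat w v))"
      by (simp add: sum_distrib_right mult.assoc)
    also have "\<dots> = (\<Sum>j = 1..N. \<Sum>w\<in>V \<union> W. c j * (phi_row j w * Amat w v))"
      by (rule sum.swap)
    finally show ?thesis by (simp add: sum_distrib_left)
  qed
  show ?thesis
  proof (cases "u \<in> V")
    case True
    then obtain k where u: "u = (0, int k)" "k \<in> {1..N}" by (auto simp: virtuals_def)
    have eq: "(\<Sum>w\<in>V \<union> W. Bmat u w * Amat w v) = (\<Sum>j = 1..N. Minv k j * ?a j)"
      using lin[of "\<lambda>j. Minv k j"] by (simp add: Bmat_def u(1))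
    show ?thesis
    proof (cases "v \<in> V")
      case True
      then obtain l where v: "v = (0, int l)" "l \<in> {1..N}" by (auto simp: virtuals_def)
      have "(\<Sum>j = 1..N. Minv k j * ?a j) = (\<Sum>j = 1..N. Minv k j * Mij j l)"
        using v by (intro sum.cong refl) (simp add: phi_row_Amat_virtual)
      then show ?thesis
        unfolding eq Minv_Mij[OF u(2) v(2)] using u v by simp
    next
      case False
      then have v: "v \<in> W" using assms(2) by blast
      then have "u \<noteq> v" using u by (auto simp: window_def)
      then show ?thesis
        unfolding eq using v by (simp add: phi_row_Amat_level)
    qed
  next
    case False
    then have u: "u \<in> W" using assms(1) by blast
    then have u0: "fst u \<noteq> 0" by (auto simp: window_def)
    define c where "c j = (\<Sum>i = 1..N. PsiLev (fst u) i (snd u) * Minv i j)" for j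
    have "Bmat u w = green_row u w - (\<Sum>j = 1..N. c j * phi_row j w)" for w
      unfolding Bmat_def c_def using u0
      by (simp add: sum_distrib_right) (rule sum.swap)
    then have eq: "(\<Sum>w\<in>V \<union> W. Bmat u w * Amat w v) =
        (\<Sum>w\<in>V \<union> W. green_row u w * Amat w v) - (\<Sum>j = 1..N. c j * ?a j)"
      using lin[of c] by (simp add: left_diff_distrib sum_subtractf)
    show ?thesis
    proof (cases "v \<in> V")
      case True
      then obtain l where v: "v = (0, int l)" "l \<in> {1..N}" by (auto simp: virtuals_def)
      have "(\<Sum>j = 1..N. c j * ?a j) = (\<Sum>j = 1..N. \<Sum>i = 1..N. PsiLev (fst u) i (snd u) * (Minv i j * Mij j l))"
        using v by (intro sum.cong refl) (simp add: phi_row_Amat_virtual c_def sum_distrib_right mult.assoc)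
      also have "\<dots> = (\<Sum>i = 1..N. PsiLev (fst u) i (snd u) * (\<Sum>j = 1..N. Minv i j * Mij j l))"
        by (subst sum.swap) (simp add: sum_distrib_left)
      also have "\<dots> = (\<Sum>i = 1..N. if i = l then PsiLev (fst u) l (snd u) else 0)"
        using v(2) by (intro sum.cong refl, subst Minv_Mij) auto
      also have "\<dots> = PsiLev (fst u) l (snd u)"
        using v(2) by simp
      finally show ?thesis
        unfolding eq unfolding v(1) green_row_Amat_virtual[OF u v(2)] using u0 by auto
    next
      case False
      then have v: "v \<in> W" using assms(2) by blast
      then show ?thesis
        unfolding eq using u by (simp add: phi_row_Amat_level green_row_Amat_level)
    qed
  qed
qed

text \<open>
  The diagonal blocks of \<open>green_row\<close> are identities and cancel against \<open>of_bool (u = v)\<close>; what remains is the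
  strictly upper part of the block inverse and the finite rank term.
\<close>
lemma corr_kernel_eq_Bmat:
  assumes "u \<in> W" "v \<in> W"
  shows "of_bool (u = v) - Bmat u v = K u v"
proof -
  obtain m x where u: "u = (m, x)" "m \<in> {1..N}"
    using assms(1) by (auto simp: window_def)
  obtain n z where v: "v = (n, z)" "n \<in> {1..N}"
    using assms(2) by (auto simp: window_def)
  have "of_bool (u = v) - green_row u v = - (Qprod q m n x z * of_bool (n > m))"
    using v(2) by (cases "m = n") (auto simp: u(1) v(1) green_row_def Qprod_same kid_def)
  then show ?thesis
    using u(2) v(2) by (simp add: u(1) v(1) Bmat_def corr_kernel_def phi_row_def)
qed

text \<open>
  Replacing the virtual rows of \<open>A\<close> by minus the combinations \<open>phi_row\<close> is a unitriangular row operation. It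
  produces \<open>[[- M, 0], [P, 1 - W]]\<close>, which is triangular once the virtual points are ranked above the
  levels.
\<close>
lemma sdet_Amat: "sdet (V \<union> W) Amat = (-1) ^ N * (\<Prod>k = 1..N. Mij k k)"
proof -
  let ?I = "V \<union> W"
  have fin: "finite ?I" by (simp add: finite_virtuals finite_window)
  define C where "C u v = (if fst u = 0 then - phi_row (nat (snd u)) v else of_bool (u = v))" for u v :: "nat \<times> int"
  define CA where "CA u v = (if fst u = 0 then (if fst v = 0 then - Mij (nat (snd u)) (nat (snd v)) else 0) else Amat u v)"
    for u v :: "nat \<times> int"
  have "sdet ?I CA = sdet ?I (\<lambda>u v. \<Sum>w\<in>?I. C u w * Amat w v)"
  proof (rule sdet_cong)
    fix u v assume u: "u \<in> ?I" and v: "v \<in> ?I"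
    show "CA u v = (\<Sum>w\<in>?I. C u w * Amat w v)"
    proof (cases "u \<in> V")
      case True
      then obtain k where k: "u = (0, int k)" "k \<in> {1..N}" by (auto simp: virtuals_def)
      have "(\<Sum>w\<in>?I. C u w * Amat w v) = - (\<Sum>w\<in>?I. phi_row k w * Amat w v)"
        by (simp add: C_def k(1) sum_negf)
      moreover have "(\<Sum>w\<in>?I. phi_row k w * Amat w v) = (if fst v = 0 then Mij k (nat (snd v)) else 0)"
      proof (cases "v \<in> V")
        case True
        then obtain l where l: "v = (0, int l)" "l \<in> {1..N}" by (auto simp: virtuals_def)
        then show ?thesis using phi_row_Amat_virtual[OF k(2) l(2)] by simp
      next
        case False
        then have "v \<in> W" using v by blast
        then show ?thesis using phi_row_Amat_level[OF k(2)] by (auto simp: window_def)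
      qed
      ultimately show ?thesis by (simp add: CA_def k(1))
    next
      case False
      then have "u \<in> W" using u by blast
      then have u0: "fst u \<noteq> 0" by (auto simp: window_def)
      then have "(\<Sum>w\<in>?I. C u w * Amat w v) = (\<Sum>w\<in>?I. if w = u then Amat u v else 0)"
        by (intro sum.cong) (auto simp: C_def)
      then show ?thesis using u u0 fin by (simp add: CA_def)
    qed
  qed
  also have "\<dots> = sdet ?I C * sdet ?I Amat"
    using fin by (rule sdet_mult)
  also have "sdet ?I C = (\<Prod>u\<in>?I. C u u)"
  proof (rule sdet_triangular[OF fin, where rk = "\<lambda>u. if fst u = 0 then nat (snd u) else N + 1"])
    fix u v assume uv: "u \<in> ?I" "v \<in> ?I" "u \<noteq> v" "C u v \<noteq> 0"
    then have "fst u = 0" by (auto simp: C_def split: if_splits)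
    with uv(1) obtain k where k: "u = (0, int k)" "k \<in> {1..N}" by (auto simp: virtuals_def window_def)
    show "(if fst u = 0 then nat (snd u) else N + 1) < (if fst v = 0 then nat (snd v) else N + 1)"
    proof (cases "v \<in> V")
      case True
      then obtain l where l: "v = (0, int l)" "l \<in> {1..N}" by (auto simp: virtuals_def)
      have "k \<le> l"
        using uv(4) by (auto simp: C_def phi_row_def k(1) l(1) Qvirt_range_def split: if_splits)
      then show ?thesis using k l uv(3) by auto
    next
      case False
      then have "v \<in> W" using uv(2) by blast
      then show ?thesis using k by (auto simp: window_def)
    qed
  qed
  also have "\<dots> = 1"
  proof (rule prod.neutral, rule ballI)
    fix u assume "u \<in> ?I"
    then consider k where "u = (0, int k)" "k \<in> {1..N}" | "fst u \<noteq> 0"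
      by (auto simp: virtuals_def window_def)
    then show "C u u = 1"
    proof cases
      case (1 k)
      then show ?thesis
        using q_pos[of k] by (simp add: C_def phi_row_def Qvirt_range_def power_int_minus)
    qed (simp add: C_def)
  qed
  finally have "sdet ?I Amat = sdet ?I CA" by simp
  also have "\<dots> = (\<Prod>u\<in>?I. CA u u)"
  proof (rule sdet_triangular[OF fin, where rk = "\<lambda>u. if fst u = 0 then N + nat (snd u) else fst u"])
    fix u v assume uv: "u \<in> ?I" "v \<in> ?I" "u \<noteq> v" "CA u v \<noteq> 0"
    show "(if fst u = 0 then N + nat (snd u) else fst u) < (if fst v = 0 then N + nat (snd v) else fst v)"
    proof (cases "fst u = 0")
      case True
      then have v0: "fst v = 0" using uv(4) by (auto simp: CA_def split: if_splits)
      obtain k where k: "u = (0, int k)" "k \<in> {1..N}" using uv(1) True by (auto simp: virtuals_def window_def)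
      obtain l where l: "v = (0, int l)" "l \<in> {1..N}" using uv(2) v0 by (auto simp: virtuals_def window_def)
      have "\<not> l < k" using uv(4) Mij_below_diagonal[OF k(2) l(2)] by (auto simp: CA_def k(1) l(1))
      then show ?thesis using k l uv(3) by auto
    next
      case False
      show ?thesis
      proof (cases "fst v = 0")
        case True
        then show ?thesis using False uv(1,2) by (auto simp: virtuals_def window_def)
      next
        case v0: False
        have "fst v = Suc (fst u)"
          using uv(3,4) False v0 by (auto simp: CA_def Amat_def Lmat_def split: if_splits)
        then show ?thesis using False v0 by simp
      qed
    qed
  qed
  also have "\<dots> = (\<Prod>u\<in>V. CA u u) * (\<Prod>u\<in>W. CA u u)"
    using finite_virtuals finite_window virtuals_window_disjoint by (rule prod.union_disjoint)
  also have "(\<Prod>u\<in>V. CA u u) = (\<Prod>k = 1..N. - Mij k k)"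
    unfolding virtuals_def by (subst prod.reindex) (auto simp: inj_on_def CA_def)
  also have "\<dots> = (-1) ^ N * (\<Prod>k = 1..N. Mij k k)"
    using prod.distrib[of "\<lambda>_. -1" "\<lambda>k. Mij k k" "{1..N}"] by simp
  also have "(\<Prod>u\<in>W. CA u u) = 1"
    by (rule prod.neutral) (auto simp: CA_def Amat_def Lmat_def window_def)
  finally show ?thesis by simp
qed

text \<open>
  Inclusion of \<open>Y\<close> is imposed by removing \<open>1\<close> from the diagonal at \<open>Y\<close>; then
  \<open>A - 1\<^sub>Y = (1 - 1\<^sub>Y A\<^sup>-\<^sup>1) A\<close>, and the first factor has unit rows off \<open>Y\<close>.
\<close>
lemma sum_minors_eq_kernel_minor:
  assumes "Y \<subseteq> W"
  shows "(\<Sum>S\<in>Pow (W - Y). sdet (V \<union> W - S) Lmat) = sdet (V \<union> W) Amat * sdet Y K"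
proof -
  let ?I = "V \<union> W"
  have fin: "finite ?I" by (simp add: finite_virtuals finite_window)
  have disj: "V \<inter> W = {}" by (rule virtuals_window_disjoint)
  let ?D = "\<lambda>u v. of_bool (u = v) - of_bool (u \<in> Y) * Bmat u v"
  have "(\<Sum>S\<in>Pow (W - Y). sdet (?I - S) Lmat) = sdet ?I (\<lambda>u v. Lmat u v + of_bool (u = v \<and> u \<in> W - Y))"
    using fin finite_window by (intro sdet_add_diagonal[symmetric]) auto
  also have "\<dots> = sdet ?I (\<lambda>u v. \<Sum>w\<in>?I. ?D u w * Amat w v)"
  proof (rule sdet_cong)
    fix u v assume u: "u \<in> ?I" and v: "v \<in> ?I"
    have "(\<Sum>w\<in>?I. ?D u w * Amat w v) =
        (\<Sum>w\<in>?I. if w = u then Amat u v else 0) - (\<Sum>w\<in>?I. of_bool (u \<in> Y) * (Bmat u w * Amat w v))"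
      unfolding sum_subtractf[symmetric] by (intro sum.cong) (auto simp: algebra_simps)
    also have "\<dots> = Amat u v - of_bool (u \<in> Y) * of_bool (u = v)"
      using u fin Bmat_left_inverse[OF u v] by (simp flip: sum_distrib_left)
    also have "\<dots> = Lmat u v + of_bool (u = v \<and> u \<in> W - Y)"
      using assms by (auto simp: Amat_def)
    finally show "Lmat u v + of_bool (u = v \<and> u \<in> W - Y) = (\<Sum>w\<in>?I. ?D u w * Amat w v)" by simp
  qed
  also have "\<dots> = sdet ?I ?D * sdet ?I Amat"
    using fin by (rule sdet_mult)
  also have "sdet ?I ?D = sdet (Y \<union> (?I - Y)) ?D"
    using assms by (simp add: Un_absorb1 le_supI2)
  also have "\<dots> = sdet Y ?D"
    using fin assms finite_subset[OF assms finite_window] by (intro sdet_unit_rows) auto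
  also have "\<dots> = sdet Y K"
  proof (rule sdet_cong)
    fix u v assume "u \<in> Y" "v \<in> Y"
    then have "u \<in> W" "v \<in> W" using assms by blast+
    then show "?D u v = K u v"
      using corr_kernel_eq_Bmat[of u v] \<open>u \<in> Y\<close> by simp
  qed
  finally show ?thesis by simp
qed

end


section \<open>Interlacing configurations as nonzero principal minors\<close>

text \<open>
  The cycle of length \<open>2m\<close> through \<open>(0, 1), (M, 1), (0, m), (M, m), (0, m - 1), \<dots>, (M, 2)\<close>.
\<close>
definition zigzag :: "nat \<Rightarrow> nat \<Rightarrow> nat \<times> nat \<Rightarrow> nat \<times> nat" where
  "zigzag M m v =
    (if fst v = 0 \<and> 1 \<le> snd v \<and> snd v \<le> m then (M, snd v)
     else if fst v = M \<and> 1 \<le> snd v \<and> snd v \<le> m then (0, if snd v = 1 then m else snd v - 1)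
     else v)"

text \<open>
  Passing from \<open>m\<close> to \<open>m + 1\<close> inserts two points into the cycle, which composes it with a 3-cycle.
\<close>
lemma sign_zigzag:
  assumes "1 \<le> m" "1 \<le> M"
  shows "permutation (zigzag M m) \<and> sign (zigzag M m) = -1"
  using assms(1)
proof (induction m rule: nat_induct_at_least)
  case base
  have "zigzag M 1 = Transposition.transpose (0, 1) (M, 1)"
    using assms(2) by (auto simp: zigzag_def transpose_def fun_eq_iff)
  then show ?case
    using assms(2) by (simp add: permutation_swap_id sign_swap_id)
next
  case (Suc m)
  let ?a = "(M, 1)" and ?b = "(0, Suc m)" and ?c = "(M, Suc m)"
  let ?s = "Transposition.transpose ?a ?b" and ?t = "Transposition.transpose ?b ?c"
  have eq: "zigzag M (Suc m) = zigzag M m \<circ> (?s \<circ> ?t)"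
  proof
    fix v
    consider "v = ?a" | "v = ?b" | "v = ?c" | "v \<noteq> ?a" "v \<noteq> ?b" "v \<noteq> ?c" by blast
    then show "zigzag M (Suc m) v = (zigzag M m \<circ> (?s \<circ> ?t)) v"
    proof cases
      case 4
      then show ?thesis
        using assms(2) Suc.hyps by (cases v) (auto simp: zigzag_def)
    qed (use assms(2) Suc.hyps in \<open>auto simp: zigzag_def\<close>)
  qed
  have st: "permutation (?s \<circ> ?t)"
    by (intro permutation_compose permutation_swap_id)
  have "sign (?s \<circ> ?t) = sign ?s * sign ?t"
    by (intro sign_compose permutation_swap_id)
  also have "\<dots> = 1"
    using assms(2) Suc.hyps by (simp add: sign_swap_id)
  finally have "sign (zigzag M (Suc m)) = sign (zigzag M m) * 1"
    unfolding eq using Suc.IH st by (metis sign_compose)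
  then have "sign (zigzag M (Suc m)) = -1"
    using Suc.IH by simp
  then show ?case
    using permutation_compose[of "zigzag M m" "?s \<circ> ?t"] Suc.IH st unfolding eq by blast
qed

text \<open>
  Sends each column of a configuration minor to the row that feeds its diagonal block: the particles
  \<open>2..k\<close> of level \<open>k\<close> to the particles of level \<open>k - 1\<close>, the first particle of level \<open>k\<close> to the virtual
  point \<open>k\<close>, and the virtual points to the particles of level \<open>N\<close>.
\<close>
definition row_shift :: "nat \<Rightarrow> nat \<times> nat \<Rightarrow> nat \<times> nat" where
  "row_shift N v =
    (if fst v = 0 \<and> 1 \<le> snd v \<and> snd v \<le> N then (N, snd v)
     else if 1 \<le> snd v \<and> snd v \<le> fst v \<and> fst v \<le> N
       then (if snd v = 1 then (0, fst v) else (fst v - 1, snd v - 1))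
     else v)"

text \<open>
  Adding a level composes the permutation with one cycle of even length.
\<close>
lemma sign_row_shift: "permutation (row_shift N) \<and> sign (row_shift N) = (-1) ^ N"
proof (induction N)
  case 0
  have "row_shift 0 = id"
    by (auto simp: row_shift_def fun_eq_iff)
  then show ?case by simp
next
  case (Suc N)
  have "row_shift (Suc N) = row_shift N \<circ> zigzag (Suc N) (Suc N)"
  proof
    fix v
    show "row_shift (Suc N) v = (row_shift N \<circ> zigzag (Suc N) (Suc N)) v"
      by (cases v) (auto simp: row_shift_def zigzag_def)
  qed
  moreover have z: "permutation (zigzag (Suc N) (Suc N))" "sign (zigzag (Suc N) (Suc N)) = -1"
    using sign_zigzag[of "Suc N" "Suc N"] by auto
  ultimately show ?case
    using Suc.IH sign_compose[of "row_shift N" "zigzag (Suc N) (Suc N)"]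
      permutation_compose[of "row_shift N" "zigzag (Suc N) (Suc N)"] by (metis mult.commute power_Suc)
qed

text \<open>
  Positions of the virtual points (row \<open>0\<close>) and of the particles.
\<close>
definition tri_ext :: "nat \<Rightarrow> (nat \<times> nat) set" where
  "tri_ext N = (\<Union>k\<in>{0..N}. {k} \<times> {1..if k = 0 then N else k})"

lemma mem_tri_ext:
  "(k, j) \<in> tri_ext N \<longleftrightarrow> k \<le> N \<and> 1 \<le> j \<and> j \<le> (if k = 0 then N else k)"
  by (auto simp: tri_ext_def)

lemma finite_tri_ext: "finite (tri_ext N)"
  by (auto simp: tri_ext_def)

lemma row_shift_permutes: "row_shift N permutes tri_ext N"
proof -
  have "row_shift N v = v" if "v \<notin> tri_ext N" for v
    using that by (cases v) (auto simp: row_shift_def mem_tri_ext)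
  moreover have "bij (row_shift N)"
    using sign_row_shift[of N] by (simp add: permutation_bijective)
  ultimately show ?thesis
    by (auto simp: permutes_def bij_iff)
qed

lemma tri_ext_eq: "tri_ext N = {0} \<times> {1..N} \<union> tri_index N"
  by (auto simp: mem_tri_ext tri_index_def split: if_splits)

definition pts :: "nat \<Rightarrow> (nat \<times> nat \<Rightarrow> int) \<Rightarrow> (nat \<times> int) set" where
  "pts N X = (\<lambda>a. (fst a, X a)) ` tri_index N"

lemma finite_tri_index: "finite (tri_index N)"
proof -
  have "tri_index N \<subseteq> {1..N} \<times> {1..N}" by (auto simp: tri_index_def)
  then show ?thesis by (rule finite_subset) simp
qed

lemma finite_pts: "finite (pts N X)"
  by (simp add: pts_def finite_tri_index)

lemma configs_row_step:
  assumes X: "X \<in> configs N" and "1 \<le> j" "j < i" "i \<le> N"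
  shows "X (i, Suc j) < X (i, j)"
proof -
  obtain i' where i: "i = Suc i'" using assms(3) by (cases i) auto
  have "X (i' + 1, j + 1) < X (i', j) \<and> X (i', j) \<le> X (i' + 1, j)"
    using assms i by (auto simp: configs_def)
  then show ?thesis using i by simp
qed

lemma configs_row_decreasing:
  assumes X: "X \<in> configs N" and "1 \<le> j" "j < j'" "j' \<le> i" "i \<le> N"
  shows "X (i, j') < X (i, j)"
  using \<open>j < j'\<close> \<open>j' \<le> i\<close>
proof (induction j' rule: nat_less_induct)
  case (1 j')
  then obtain m where m: "j' = Suc m" by (cases j') auto
  have step: "X (i, Suc m) < X (i, m)" if "1 \<le> m"
    using configs_row_step[OF X that] 1(3) m assms(5) by simp
  show ?case
  proof (cases "m = j")
    case True
    then show ?thesis using step assms(2) m by simp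
  next
    case False
    then have "X (i, m) < X (i, j)" using 1 m by auto
    then show ?thesis using step assms(2) m False 1(2) by auto
  qed
qed

lemma configs_inj_on_row:
  assumes X: "X \<in> configs N" and "i \<le> N"
  shows "inj_on (\<lambda>j. X (i, j)) {1..i}"
proof (rule linorder_inj_onI')
  fix j j' assume "j \<in> {1..i}" "j' \<in> {1..i}" "j < j'"
  then show "X (i, j) \<noteq> X (i, j')"
    using configs_row_decreasing[OF X, of j j' i] assms(2) by auto
qed

lemma inj_on_tri_index:
  assumes X: "X \<in> configs N"
  shows "inj_on (\<lambda>a. (fst a, X a)) (tri_index N)"
proof (rule inj_onI)
  fix a b assume a: "a \<in> tri_index N" and b: "b \<in> tri_index N" and eq: "(fst a, X a) = (fst b, X b)"
  obtain i j where a': "a = (i, j)" by (cases a)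
  obtain j' where b': "b = (i, j')" using eq a' by (cases b) auto
  have "j = j'"
    using inj_onD[OF configs_inj_on_row[OF X, of i], of j j'] a b eq
    by (auto simp: a' b' tri_index_def)
  then show "a = b" by (simp add: a' b')
qed

text \<open>
  Rows of a configuration are strictly decreasing, so they can be recovered from their sets of values.
\<close>
lemma inj_on_pts: "inj_on (pts N) (configs N)"
proof (rule inj_onI)
  fix X X' assume X: "X \<in> configs N" and X': "X' \<in> configs N" and eq: "pts N X = pts N X'"
  have "X (i, j) = X' (i, j)" if "1 \<le> j" "j \<le> i" "i \<le> N" for i j
  proof -
    have sorted: "sorted_wrt (>) (map (\<lambda>j. Z (i, j)) [1..<i + 1])" if "Z \<in> configs N" for Z
      unfolding sorted_wrt_map
    proof (rule sorted_wrt_mono_rel[OF _ sorted_wrt_upt])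
      fix x y assume "x \<in> set [1..<i + 1]" "y \<in> set [1..<i + 1]" "x < y"
      then show "Z (i, x) > Z (i, y)"
        using configs_row_decreasing[OF that, of x y i] \<open>i \<le> N\<close> by auto
    qed
    have set: "set (map (\<lambda>j. Z (i, j)) [1..<i + 1]) = {x. (i, x) \<in> pts N Z}" for Z
      using \<open>i \<le> N\<close> by (auto simp: pts_def tri_index_def image_iff)
    have "sorted_wrt (<) (rev (map (\<lambda>j. Z (i, j)) [1..<i + 1]))" if "Z \<in> configs N" for Z
      using sorted[OF that] by (simp add: sorted_wrt_rev del: upt_Suc)
    then have "rev (map (\<lambda>j. X (i, j)) [1..<i + 1]) = rev (map (\<lambda>j. X' (i, j)) [1..<i + 1])"
      using X X' set[of X] set[of X'] eq by (intro strict_sorted_equal) (auto simp del: upt_Suc)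
    then have "map (\<lambda>j. X (i, j)) [1..<i + 1] = map (\<lambda>j. X' (i, j)) [1..<i + 1]"
      by (simp only: rev_is_rev_conv)
    moreover have "j \<in> set [1..<i + 1]" using that by auto
    ultimately show ?thesis by (metis map_eq_conv)
  qed
  then have "X a = X' a" if "a \<in> tri_index N" for a
    using that by (auto simp: tri_index_def)
  moreover have "X \<in> tri_index N \<rightarrow>\<^sub>E UNIV" "X' \<in> tri_index N \<rightarrow>\<^sub>E UNIV"
    using X X' by (auto simp: configs_def)
  ultimately show "X = X'"
    by (meson PiE_ext)
qed

text \<open>
  The enumeration comes with the counting description of its values, since interlacing will be derived from
  counts of larger elements.
\<close>
lemma decreasing_enumeration:
  fixes A :: "int set"
  assumes "finite A"
  shows "\<exists>f. f ` {1..card A} = A \<and> (\<forall>j j'. 1 \<le> j \<and> j < j' \<and> j' \<le> card A \<longrightarrow> f j' < f j) \<and>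
    (\<forall>j y. 1 \<le> j \<and> j \<le> card A \<longrightarrow> (y < f j \<longleftrightarrow> j \<le> card {x \<in> A. y < x}))"
  using assms
proof (induction A rule: finite_linorder_min_induct)
  case empty
  then show ?case by auto
next
  case (insert b A)
  then obtain f where f: "f ` {1..card A} = A"
    "\<And>j j'. 1 \<le> j \<Longrightarrow> j < j' \<Longrightarrow> j' \<le> card A \<Longrightarrow> f j' < f j"
    "\<And>j y. 1 \<le> j \<Longrightarrow> j \<le> card A \<Longrightarrow> (y < f j \<longleftrightarrow> j \<le> card {x \<in> A. y < x})"
    by blast
  define g where "g = f(Suc (card A) := b)"
  have card: "card (insert b A) = Suc (card A)"
    using insert.hyps by (subst card_insert_disjoint) auto
  have mem: "f j \<in> A" if "1 \<le> j" "j \<le> card A" for j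
    using f(1) that by auto
  have "g ` {1..Suc (card A)} = insert b A"
  proof -
    have "{1..Suc (card A)} = insert (Suc (card A)) {1..card A}" by auto
    moreover have "g ` {1..card A} = A"
    proof -
      have "g ` {1..card A} = f ` {1..card A}" by (intro image_cong) (auto simp: g_def)
      then show ?thesis using f(1) by (rule trans)
    qed
    moreover have "g (Suc (card A)) = b" by (simp add: g_def)
    ultimately show ?thesis by (simp only: image_insert)
  qed
  moreover have "g j' < g j" if "1 \<le> j" "j < j'" "j' \<le> Suc (card A)" for j j'
    using that f(2)[of j j'] mem[of j] insert.hyps(2) by (auto simp: g_def)
  moreover have "y < g j \<longleftrightarrow> j \<le> card {x \<in> insert b A. y < x}" if j: "1 \<le> j" "j \<le> Suc (card A)" for j y
  proof (cases "y < b")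
    case True
    then have "{x \<in> insert b A. y < x} = insert b A"
      using insert.hyps(2) by force
    moreover have "y < g j"
      using j True mem[of j] insert.hyps(2) by (force simp: g_def)
    ultimately show ?thesis using j card by simp
  next
    case False
    then have eq: "{x \<in> insert b A. y < x} = {x \<in> A. y < x}" by auto
    have "card {x \<in> A. y < x} \<le> card A"
      using insert.hyps(1) by (intro card_mono) auto
    then show ?thesis
      unfolding eq using False j f(3)[of j y] by (auto simp: g_def le_Suc_eq)
  qed
  ultimately show ?case
    unfolding card by blast
qed

lemma strictly_increasing_bounded_eq:
  fixes g :: "nat \<Rightarrow> nat"
  assumes step: "\<And>j. 1 \<le> j \<Longrightarrow> j < k \<Longrightarrow> g j < g (Suc j)" and "g k < k" and j: "1 \<le> j" "j \<le> k"
  shows "g j = j - 1"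
proof -
  have grow: "g a + (b - a) \<le> g b" if "1 \<le> a" "a \<le> b" "b \<le> k" for a b
    using that(2,3)
  proof (induction b rule: dec_induct)
    case (step b)
    then show ?case using assms(1)[of b] that(1) by simp
  qed simp
  show ?thesis
    using grow[of 1 j] grow[of j k] j assms(2) by simp
qed

lemma singleton_times_interval: "{k} \<times> {1..n} = (\<lambda>j. (k, j + 1)) ` {0..<n}" for k n :: nat
proof -
  have "{k} \<times> {1..n} = Pair k ` Suc ` {0..<n}"
    unfolding image_Suc_atLeastLessThan by auto
  then show ?thesis
    by (simp only: image_image Suc_eq_plus1)
qed

context interlacing_data
begin

text \<open>
  After the row permutation \<open>row_shift\<close> the minor is block diagonal. The block of level \<open>k\<close> is the matrix of
  \<open>Qlevel\<close> with signs in all rows but the first, which contributes \<open>(-1)\<^sup>k\<^sup>-\<^sup>1\<close>; these signs multiply to the sign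
  in \<open>Zbar\<close>. The block of the virtual points is the transposed matrix of the functions \<open>\<Psi>\<close>.
\<close>
lemma pts_minor:
  assumes X: "X \<in> configs N" and N: "1 \<le> N"
  shows "sdet (virtuals N \<union> pts N X) Lmat =
    (-1) ^ N * (-1) ^ (N * (N - 1) div 2) * (\<Prod>k = 1..N. det (mat_of1 k (Qlevel q X k)))
      * det (mat_of1 N (\<lambda>i j. PsiTop i (X (N, j))))"
proof -
  define e where "e a = (if fst a = 0 then (0, int (snd a)) else (fst a, X a))" for a :: "nat \<times> nat"
  define h where "h a b = Lmat (e (row_shift N a)) (e b)" for a b
  \<comment> \<open>\<open>e\<close> replaces positions by the points that occupy them; \<open>h\<close> is the minor with its rows permuted.\<close>
  have e_inj: "inj_on e (tri_ext N)"
  proof (rule inj_onI)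
    fix a b assume ab: "a \<in> tri_ext N" "b \<in> tri_ext N" "e a = e b"
    show "a = b"
    proof (cases "fst a = 0")
      case True
      then show ?thesis using ab by (cases a; cases b) (auto simp: e_def split: if_splits)
    next
      case False
      then have b0: "fst b \<noteq> 0" using ab(3) by (auto simp: e_def split: if_splits)
      then have "a \<in> tri_index N" "b \<in> tri_index N"
        using False ab by (auto simp: tri_ext_eq)
      then show ?thesis
        using inj_onD[OF inj_on_tri_index[OF X], of a b] ab(3) False b0 by (simp add: e_def)
    qed
  qed
  have "{0 :: nat} \<times> {1..N} = Pair 0 ` {1..N}" by auto
  then have "e ` ({0} \<times> {1..N}) = (\<lambda>k. e (0, k)) ` {1..N}"
    by (simp only: image_image)
  then have "e ` ({0} \<times> {1..N}) = virtuals N"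
    by (simp add: virtuals_def e_def)
  moreover have "e ` tri_index N = pts N X"
    unfolding pts_def by (intro image_cong refl) (auto simp: e_def tri_index_def)
  ultimately have image: "virtuals N \<union> pts N X = e ` tri_ext N"
    by (simp add: tri_ext_eq image_Un)
  have "sdet (tri_ext N) h = (-1) ^ N * sdet (tri_ext N) (\<lambda>a b. Lmat (e a) (e b))"
    unfolding h_def
    using sdet_permute_rows[OF finite_tri_ext row_shift_permutes, where f = "\<lambda>a b. Lmat (e a) (e b)"]
      sign_row_shift[of N] by simp
  then have "(-1) ^ N * sdet (tri_ext N) h = sdet (tri_ext N) (\<lambda>a b. Lmat (e a) (e b))"
    by (simp flip: power_add mult_2)
  then have 1: "sdet (virtuals N \<union> pts N X) Lmat = (-1) ^ N * sdet (tri_ext N) h"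
    unfolding image by (simp add: sdet_reindex[OF finite_tri_ext e_inj])
  let ?B = "\<lambda>k :: nat. {k} \<times> {1..if k = 0 then N else k}"
  have 2: "sdet (tri_ext N) h = (\<Prod>k = 0..N. sdet (?B k) h)"
    unfolding tri_ext_def
  proof (rule sdet_block_diagonal)
    fix k l :: nat and a b :: "nat \<times> nat"
    assume k: "k \<in> {0..N}" and l: "l \<in> {0..N}" and "k \<noteq> l" and a: "a \<in> ?B k" and b: "b \<in> ?B l"
    obtain i where i: "a = (k, i)" "1 \<le> i" "i \<le> (if k = 0 then N else k)" using a by auto
    obtain j where j: "b = (l, j)" "1 \<le> j" "j \<le> (if l = 0 then N else l)" using b by auto
    consider "k = 0" | "k \<noteq> 0" "i = 1" | "k \<noteq> 0" "i \<ge> 2" using i(2) by linarith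
    then show "h a b = 0"
    proof cases
      case 1
      then have "row_shift N a = (N, i)" using i by (simp add: row_shift_def)
      then show ?thesis using 1 j l N \<open>k \<noteq> l\<close> by (simp add: h_def e_def Lmat_def)
    next
      case 2
      then have "row_shift N a = (0, k)" using i k by (simp add: row_shift_def)
      then show ?thesis using 2 j l \<open>k \<noteq> l\<close> by (simp add: h_def e_def Lmat_def)
    next
      case 3
      then have "row_shift N a = (k - 1, i - 1)" "k - 1 \<noteq> 0" "k - 1 \<noteq> N"
        using i k by (auto simp: row_shift_def)
      then show ?thesis using 3 j l k \<open>k \<noteq> l\<close> by (simp add: h_def e_def Lmat_def)
    qed
  qed auto
  have level: "sdet (?B k) h = (-1) ^ (k - 1) * det (mat_of1 k (Qlevel q X k))" if k: "k \<in> {1..N}" for k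
  proof -
    let ?s = "\<lambda>a :: nat \<times> nat. if snd a = 1 then 1 else (-1 :: real)"
    let ?g = "\<lambda>a b :: nat \<times> nat. Qlevel q X k (snd a) (snd b)"
    have B: "?B k = (\<lambda>j. (k, j + 1)) ` {0..<k}"
      using k by (simp only: singleton_times_interval) simp
    have inj: "inj_on (\<lambda>j :: nat. (k, j + 1)) {0..<k}" by (auto simp: inj_on_def)
    have "sdet (?B k) h = sdet (?B k) (\<lambda>a b. ?s a * ?g a b)"
    proof (rule sdet_cong)
      fix a b assume a: "a \<in> ?B k" and b: "b \<in> ?B k"
      obtain i where i: "a = (k, i)" "1 \<le> i" "i \<le> k" using a k by auto
      obtain j where j: "b = (k, j)" "1 \<le> j" "j \<le> k" using b k by auto
      show "h a b = ?s a * ?g a b"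
      proof (cases "i = 1")
        case True
        then have "row_shift N a = (0, k)" using i k by (simp add: row_shift_def)
        then show ?thesis using True i j k by (simp add: h_def e_def Lmat_def Qlevel_def)
      next
        case False
        then have "row_shift N a = (k - 1, i - 1)" "k - 1 \<noteq> 0" "Suc (k - 1) = k"
          using i k by (auto simp: row_shift_def)
        then show ?thesis using False i j k by (simp add: h_def e_def Lmat_def Qlevel_def)
      qed
    qed
    also have "\<dots> = (\<Prod>a\<in>?B k. ?s a) * sdet (?B k) ?g"
      by (rule sdet_scale_rows)
    also have "sdet (?B k) ?g = det (mat_of1 k (Qlevel q X k))"
      unfolding B using det_eq_sdet_reindex[OF inj, of ?g] by (simp add: mat_of1_def)
    also have "(\<Prod>a\<in>?B k. ?s a) = (\<Prod>j = 0..<k. if j = 0 then 1 else -1)"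
      unfolding B by (subst prod.reindex[OF inj]) auto
    also have "\<dots> = (\<Prod>j = 1..<k. -1)"
      using k by (subst prod.atLeast_Suc_lessThan) auto
    finally show ?thesis by simp
  qed
  have top: "sdet (?B 0) h = det (mat_of1 N (\<lambda>i j. PsiTop i (X (N, j))))"
  proof -
    let ?g = "\<lambda>a b :: nat \<times> nat. PsiTop (snd a) (X (N, snd b))"
    have B: "?B 0 = (\<lambda>j. (0, j + 1)) ` {0..<N}"
      by (simp only: singleton_times_interval if_True simp_thms)
    have inj: "inj_on (\<lambda>j :: nat. (0 :: nat, j + 1)) {0..<N}" by (auto simp: inj_on_def)
    have "sdet (?B 0) h = sdet (?B 0) (\<lambda>a b. ?g b a)"
    proof (rule sdet_cong)
      fix a b assume a: "a \<in> ?B 0" and b: "b \<in> ?B 0"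
      obtain i where i: "a = (0, i)" "1 \<le> i" "i \<le> N" using a by auto
      obtain j where j: "b = (0, j)" "1 \<le> j" "j \<le> N" using b by auto
      have "row_shift N a = (N, i)" using i by (simp add: row_shift_def)
      then show "h a b = ?g b a" using i j N by (simp add: h_def e_def Lmat_def)
    qed
    also have "\<dots> = sdet (?B 0) ?g"
      by (rule sdet_transpose) simp
    also have "\<dots> = det (mat_of1 N (\<lambda>i j. PsiTop i (X (N, j))))"
      unfolding B using det_eq_sdet_reindex[OF inj, of ?g] by (simp add: mat_of1_def)
    finally show ?thesis .
  qed
  have signs: "(\<Prod>k = 1..N. (-1) ^ (k - 1)) = (-1 :: real) ^ (N * (N - 1) div 2)"
  proof -
    have "(\<Sum>k = 1..n. k - 1) = n * (n - 1) div 2" for n :: nat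
    proof (induction n)
      case (Suc n)
      have "Suc n * (Suc n - 1) = n * (n - 1) + 2 * n" by (cases n) auto
      then show ?case using Suc by simp
    qed simp
    then show ?thesis by (simp add: power_sum[symmetric])
  qed
  have "(\<Prod>k = 0..N. sdet (?B k) h) = sdet (?B 0) h * (\<Prod>k = 1..N. sdet (?B k) h)"
    using prod.atLeast_Suc_atMost[of 0 N "\<lambda>k. sdet (?B k) h"] by simp
  also have "(\<Prod>k = 1..N. sdet (?B k) h) = (\<Prod>k = 1..N. (-1) ^ (k - 1) * det (mat_of1 k (Qlevel q X k)))"
    by (rule prod.cong[OF refl]) (rule level)
  also have "\<dots> = (-1) ^ (N * (N - 1) div 2) * (\<Prod>k = 1..N. det (mat_of1 k (Qlevel q X k)))"
    unfolding prod.distrib signs ..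
  finally show ?thesis
    unfolding 1 2 top by simp
qed

lemma Zbar_eq: "Zbar N q p r t y = (-1) ^ (N * (N - 1) div 2) * (\<Prod>k = 1..N. Mij k k)"
proof -
  have "(\<Prod>k = 1..N. Mij k k) = (\<Prod>k = 1..N. (\<Prod>l = r + 1..t. 1 + p l * q k) * q k powi (y k - int k))"
    by (rule prod.cong[OF refl]) (rule Mij_diagonal)
  then show ?thesis
    by (simp add: Zbar_def prod.distrib)
qed

lemma pts_minor_eq_weight:
  assumes X: "X \<in> configs N" and N: "1 \<le> N"
  shows "sdet (virtuals N \<union> pts N X) Lmat =
    (-1) ^ N * (\<Prod>k = 1..N. Mij k k) * signed_weight N q p r t y X"
proof -
  define s :: real where "s = (-1) ^ (N * (N - 1) div 2)"
  have s: "s * s = 1" by (simp add: s_def flip: power_add mult_2)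
  define m where "m = (\<Prod>k = 1..N. Mij k k)"
  have m: "m \<noteq> 0" using Mij_diagonal_nonzero by (simp add: m_def)
  have "s \<noteq> 0" using s by auto
  have *: "m * (1 / (s * m)) = s"
    using s m \<open>s \<noteq> 0\<close> by (simp add: field_simps)
  have "c * s * P * D = c * m * (1 / (s * m) * P * D)" for c P D :: real
  proof -
    have "c * m * (1 / (s * m) * P * D) = c * (m * (1 / (s * m))) * P * D"
      by (simp only: mult.assoc)
    then show ?thesis unfolding * ..
  qed
  then show ?thesis
    unfolding pts_minor[OF assms] signed_weight_def Zbar_eq s_def[symmetric] m_def[symmetric] .
qed

text \<open>
  A permutation with a nonzero term maps the virtual point \<open>k\<close> and the points of level \<open>k - 1\<close> onto the points
  of level \<open>k\<close>, so level \<open>k\<close> has \<open>k\<close> points. A column \<open>(k, x)\<close> depends, up to the factor \<open>q\<^sub>k\<^sup>x\<close>, only on the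
  number of points of level \<open>k - 1\<close> above \<open>x\<close>. These numbers lie in \<open>{0..k - 1}\<close> and must be distinct for
  the \<open>k\<close> columns of the level, so the \<open>j\<close>-th largest point of level \<open>k\<close> has exactly \<open>j - 1\<close> points of level \<open>k - 1\<close>
  above it. This is interlacing.
\<close>
lemma nonzero_minor_imp_config:
  assumes S: "S \<subseteq> window N lo hi" and nz: "sdet (virtuals N \<union> S) Lmat \<noteq> 0"
  shows "\<exists>X\<in>configs N. pts N X = S"
proof -
  let ?I = "virtuals N \<union> S"
  have finS: "finite S" using S finite_window by (rule finite_subset)
  then have fin: "finite ?I" by (simp add: finite_virtuals)
  define lev where "lev k = {x. (k, x) \<in> S}" for k
  have lev0: "lev 0 = {}" using S by (auto simp: lev_def window_def)
  have finlev: "finite (lev k)" for k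
  proof -
    have "lev k \<subseteq> snd ` S" by (force simp: lev_def)
    then show ?thesis using finS by (rule finite_subset[OF _ finite_imageI])
  qed
  obtain \<pi> where \<pi>: "\<pi> permutes ?I" "\<And>u. u \<in> ?I \<Longrightarrow> Lmat u (\<pi> u) \<noteq> 0"
    using sdet_nonzero_imp_permutation[OF fin nz] by blast
  have card_Suc: "card (lev k) = Suc (card (lev (k - 1)))" if k: "k \<in> {1..N}" for k
  proof -
    let ?D = "insert (0, int k) ({k - 1} \<times> lev (k - 1))"
    have D: "?D \<subseteq> ?I" using k by (auto simp: virtuals_def lev_def)
    \<comment> \<open>Level \<open>k\<close> is reached in \<open>L\<close> exactly from the virtual point \<open>k\<close> and from level \<open>k - 1\<close>.\<close>
    have "\<pi> ` ?D = {k} \<times> lev k"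
    proof (intro equalityI subsetI)
      fix v assume "v \<in> \<pi> ` ?D"
      then obtain u where u: "u \<in> ?D" "v = \<pi> u" by blast
      have uI: "u \<in> ?I" using u(1) D by blast
      have nz: "Lmat u v \<noteq> 0" using \<pi>(2)[OF uI] u(2) by simp
      have vI: "v \<in> ?I" using permutes_in_image[OF \<pi>(1)] uI u(2) by simp
      have "fst v = k"
      proof (cases "fst u = 0")
        case True
        then have "u = (0, int k)" using u(1) lev0 by auto
        then show ?thesis using nz by (auto simp: Lmat_def split: if_splits)
      next
        case False
        then have "fst u = k - 1" "k - 1 \<noteq> N" using u(1) k by auto
        then show ?thesis using nz False by (auto simp: Lmat_def split: if_splits)
      qed
      then show "v \<in> {k} \<times> lev k"
        using vI k by (cases v) (auto simp: virtuals_def lev_def)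
    next
      fix v assume v: "v \<in> {k} \<times> lev k"
      then have vI: "v \<in> ?I" by (auto simp: lev_def)
      then obtain u where u: "u \<in> ?I" "v = \<pi> u"
        using permutes_image[OF \<pi>(1)] by (metis imageE)
      have nz: "Lmat u v \<noteq> 0" using \<pi>(2)[OF u(1)] u(2) by simp
      have "u \<in> ?D"
      proof (cases "fst u = 0")
        case True
        then show ?thesis using nz v k by (cases u) (auto simp: Lmat_def split: if_splits)
      next
        case False
        then have "u \<in> S" using u(1) by (auto simp: virtuals_def)
        then show ?thesis using nz v k False by (cases u) (auto simp: Lmat_def lev_def split: if_splits)
      qed
      then show "v \<in> \<pi> ` ?D" using u(2) by blast
    qed
    then have "card ({k} \<times> lev k) = card ?D"
      using card_image[OF inj_on_subset[OF permutes_inj_on[OF \<pi>(1)] D]] by simp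
    moreover have "(0, int k) \<notin> {k - 1} \<times> lev (k - 1)"
      using lev0 by auto
    ultimately show ?thesis
      using finlev by (simp add: card_cartesian_product)
  qed
  have card: "card (lev k) = k" if "k \<le> N" for k
    using that
  proof (induction k)
    case 0
    then show ?case by (simp add: lev0)
  next
    case (Suc k)
    then show ?case using card_Suc[of "Suc k"] by simp
  qed
  define above where "above k x = card {z \<in> lev (k - 1). x < z}" for k x
  have above_neq: "above k x < above k x'" if k: "k \<in> {1..N}" and x: "x \<in> lev k" "x' \<in> lev k" "x' < x" for k x x'
  proof (rule ccontr)
    assume "\<not> above k x < above k x'"
    then have "card {z \<in> lev (k - 1). x' < z} \<le> card {z \<in> lev (k - 1). x < z}"
      by (simp add: above_def)
    moreover have "{z \<in> lev (k - 1). x < z} \<subseteq> {z \<in> lev (k - 1). x' < z}"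
      using x(3) by auto
    ultimately have eq: "{z \<in> lev (k - 1). x < z} = {z \<in> lev (k - 1). x' < z}"
      using finlev[of "k - 1"] by (intro card_seteq) auto
    have qk: "q k \<noteq> 0" using q_pos[OF k] by simp
    have pw: "q k powi x = q k powi (x - x') * q k powi x'"
      using qk by (simp flip: power_int_add)
    \<comment> \<open>With equal counts, the columns \<open>(k, x)\<close> and \<open>(k, x')\<close> are proportional.\<close>
    have "sdet ?I Lmat = 0"
    proof (rule sdet_proportional_columns[OF fin, where i = "(k, x)" and j = "(k, x')" and c = "q k powi (x - x')"])
      show "(k, x) \<in> ?I" "(k, x') \<in> ?I" "(k, x) \<noteq> (k, x')"
        using x by (auto simp: lev_def)
      fix u assume u: "u \<in> ?I"
      show "Lmat u (k, x) = q k powi (x - x') * Lmat u (k, x')"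
      proof (cases "fst u \<noteq> 0 \<and> k = Suc (fst u)")
        case True
        then have "u \<in> S" using u by (auto simp: virtuals_def)
        then have "snd u \<in> lev (k - 1)" using True by (cases u) (auto simp: lev_def)
        then have iff: "x < snd u \<longleftrightarrow> x' < snd u" using eq by blast
        have "q k powi (x - snd u) = q k powi (x - x') * q k powi (x' - snd u)"
          using qk by (simp flip: power_int_add)
        then show ?thesis using True iff by (simp add: Lmat_def Qker_def)
      next
        case False
        then show ?thesis using k by (auto simp: Lmat_def Qvirt_def pw)
      qed
    qed
    then show False using nz by simp
  qed
  define enum where "enum k g \<longleftrightarrow> g ` {1..card (lev k)} = lev k
      \<and> (\<forall>j j'. 1 \<le> j \<and> j < j' \<and> j' \<le> card (lev k) \<longrightarrow> g j' < g j)
      \<and> (\<forall>j x. 1 \<le> j \<and> j \<le> card (lev k) \<longrightarrow> (x < g j \<longleftrightarrow> j \<le> card {z \<in> lev k. x < z}))"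
    for k and g :: "nat \<Rightarrow> int"
  have "\<forall>k. \<exists>g. enum k g"
    unfolding enum_def using decreasing_enumeration[OF finlev] by (rule allI)
  then obtain f where enum: "enum k (f k)" for k
    using choice[of enum] by auto
  have f: "f k ` {1..card (lev k)} = lev k"
    "1 \<le> j \<Longrightarrow> j < j' \<Longrightarrow> j' \<le> card (lev k) \<Longrightarrow> f k j' < f k j"
    "1 \<le> j \<Longrightarrow> j \<le> card (lev k) \<Longrightarrow> (x < f k j \<longleftrightarrow> j \<le> card {z \<in> lev k. x < z})" for k j j' x
    using enum[of k] unfolding enum_def by blast+
  have f_mem: "f k j \<in> lev k" if "k \<le> N" "1 \<le> j" "j \<le> k" for k j
    using f(1)[of k] card[OF that(1)] that by auto
  \<comment> \<open>The counts increase strictly along the \<open>k\<close> points and stay below \<open>k\<close>, which leaves one possibility.\<close>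
  have above_f: "above k (f k j) = j - 1" if k: "k \<in> {1..N}" and j: "1 \<le> j" "j \<le> k" for k j
  proof (rule strictly_increasing_bounded_eq[OF _ _ j])
    fix i assume i: "1 \<le> i" "i < k"
    show "above k (f k i) < above k (f k (Suc i))"
      using i k f(2)[of i "Suc i" k] card[of k] f_mem[of k i] f_mem[of k "Suc i"]
      by (intro above_neq) auto
  next
    have "above k (f k k) \<le> card (lev (k - 1))"
      unfolding above_def using finlev by (intro card_mono) auto
    also have "\<dots> = k - 1" using k by (intro card) auto
    finally show "above k (f k k) < k" using k by auto
  qed
  define X where "X = restrict (\<lambda>(k, j). f k j) (tri_index N)"
  have X: "X (k, j) = f k j" if "1 \<le> j" "j \<le> k" "k \<le> N" for k j
    using that by (simp add: X_def tri_index_def)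
  have "X \<in> configs N"
    unfolding configs_def
  proof (intro CollectI conjI allI impI)
    show "X \<in> tri_index N \<rightarrow>\<^sub>E UNIV" by (simp add: X_def)
    fix i j assume ij: "1 \<le> j \<and> j \<le> i \<and> i < N"
    have iff: "z < f i j \<longleftrightarrow> j \<le> above (i + 1) z" for z
      using f(3)[of j i z] card[of i] ij by (simp add: above_def)
    show "X (i + 1, j + 1) < X (i, j)"
      using iff[of "f (i + 1) (j + 1)"] above_f[of "i + 1" "j + 1"] ij by (simp add: X)
    show "X (i, j) \<le> X (i + 1, j)"
      using iff[of "f (i + 1) j"] above_f[of "i + 1" j] ij by (auto simp: X not_less[symmetric])
  qed
  moreover have "pts N X = S"
  proof (intro equalityI subsetI)
    fix v assume "v \<in> pts N X"
    then obtain k j where kj: "v = (k, X (k, j))" "1 \<le> j" "j \<le> k" "k \<le> N"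
      by (auto simp: pts_def tri_index_def)
    then show "v \<in> S" using f_mem[of k j] by (simp add: X lev_def)
  next
    fix v assume v: "v \<in> S"
    obtain k x where kx: "v = (k, x)" by (cases v)
    have k: "k \<in> {1..N}" using v S kx by (auto simp: window_def)
    have "x \<in> f k ` {1..k}"
      using f(1)[of k] card[of k] k v kx by (auto simp: lev_def)
    then obtain j where "j \<in> {1..k}" "x = f k j" by blast
    then show "v \<in> pts N X"
      unfolding pts_def
    proof (intro image_eqI[of _ _ "(k, j)"])
      show "v = (fst (k, j), X (k, j))"
        using k kx \<open>j \<in> {1..k}\<close> \<open>x = f k j\<close> by (simp add: X)
      show "(k, j) \<in> tri_index N"
        using k \<open>j \<in> {1..k}\<close> by (simp add: tri_index_def)
    qed
  qed
  ultimately show ?thesis by blast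
qed

end


section \<open>Fredholm expansion\<close>

text \<open>
  Accounts for the factor \<open>1 / d!\<close> in the Fredholm expansion.
\<close>
lemma card_injective_enumerations:
  assumes "finite Y" "card Y = d"
  shows "card {u \<in> {..<d} \<rightarrow>\<^sub>E Y. inj_on u {..<d}} = fact d"
proof -
  let ?L = "{xs. length xs = d \<and> distinct xs \<and> set xs \<subseteq> Y}"
  have "bij_betw (\<lambda>u. map u [0..<d]) {u \<in> {..<d} \<rightarrow>\<^sub>E Y. inj_on u {..<d}} ?L"
  proof (rule bij_betw_byWitness[where f' = "\<lambda>xs. restrict (nth xs) {..<d}"])
    show "\<forall>u\<in>{u \<in> {..<d} \<rightarrow>\<^sub>E Y. inj_on u {..<d}}. restrict (nth (map u [0..<d])) {..<d} = u"
      by (auto simp: fun_eq_iff PiE_def extensional_def)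
    show "\<forall>xs\<in>?L. map (restrict (nth xs) {..<d}) [0..<d] = xs"
      by (auto intro!: nth_equalityI)
    show "(\<lambda>u. map u [0..<d]) ` {u \<in> {..<d} \<rightarrow>\<^sub>E Y. inj_on u {..<d}} \<subseteq> ?L"
      by (auto simp: distinct_map lessThan_atLeast0)
    show "(\<lambda>xs. restrict (nth xs) {..<d}) ` ?L \<subseteq> {u \<in> {..<d} \<rightarrow>\<^sub>E Y. inj_on u {..<d}}"
    proof (intro image_subsetI CollectI conjI)
      fix xs assume xs: "xs \<in> ?L"
      then show "restrict (nth xs) {..<d} \<in> {..<d} \<rightarrow>\<^sub>E Y"
        by (auto simp: subset_iff)
      show "inj_on (restrict (nth xs) {..<d}) {..<d}"
        using xs by (auto simp: inj_on_def nth_eq_iff_index_eq)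
    qed
  qed
  then have "card {u \<in> {..<d} \<rightarrow>\<^sub>E Y. inj_on u {..<d}} = card ?L"
    by (rule bij_betw_same_card)
  also have "\<dots> = \<Prod>{card Y - d + 1..card Y}"
    using assms by (intro card_lists_distinct_length_eq) auto
  also have "\<dots> = fact d"
    using assms by (simp add: fact_prod)
  finally show ?thesis .
qed

lemma fredholm_minor_eq_sdet:
  "fredholm_minor A d u = (if inj_on u {..<d} then sdet (u ` {..<d}) A else 0)"
proof (cases "inj_on u {..<d}")
  case True
  then show ?thesis
    using det_eq_sdet_reindex[of u d A] by (simp add: fredholm_minor_def lessThan_atLeast0)
next
  case False
  then obtain a b where ab: "a < d" "b < d" "a \<noteq> b" "u a = u b"
    by (auto simp: inj_on_def)
  have "fredholm_minor A d u = sdet {0..<d} (\<lambda>a b. A (u a) (u b))"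
    unfolding fredholm_minor_def by (rule det_eq_sdet)
  also have "\<dots> = 0"
    using ab by (intro sdet_identical_rows[of _ a b]) auto
  finally show ?thesis using False by simp
qed

text \<open>
  The Fredholm expansion sums over ordered tuples; tuples with a repetition have equal rows, and each
  \<open>d\<close>-element set arises from \<open>d!\<close> injective tuples.
\<close>
lemma fredholm_finitely_supported_minors:
  assumes W: "finite W" "W \<subseteq> S"
    and vanish: "\<And>Y. finite Y \<Longrightarrow> Y \<subseteq> S \<Longrightarrow> \<not> Y \<subseteq> W \<Longrightarrow> sdet Y A = 0"
  shows "fredholm_converges S A" and "fredholm_det S A = (\<Sum>Y\<in>Pow W. sdet Y A)"
proof -
  define U where "U d = {u \<in> {..<d} \<rightarrow>\<^sub>E W. inj_on u {..<d}}" for d :: nat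
  have finU: "finite (U d)" for d
  proof -
    have "finite ({..<d} \<rightarrow>\<^sub>E W)" using W(1) by (intro finite_PiE) auto
    then show ?thesis unfolding U_def by (rule rev_finite_subset) auto
  qed
  have U_sub: "U d \<subseteq> {..<d} \<rightarrow>\<^sub>E S" for d
    using W(2) by (auto simp: U_def)
  have zero: "fredholm_minor A d u = 0" if u: "u \<in> ({..<d} \<rightarrow>\<^sub>E S) - U d" for d u
  proof (cases "inj_on u {..<d}")
    case True
    have "\<not> u ` {..<d} \<subseteq> W"
      using u True by (auto simp: U_def PiE_def Pi_def)
    moreover have "u ` {..<d} \<subseteq> S"
      using u by auto
    ultimately show ?thesis
      using vanish[of "u ` {..<d}"] True by (simp add: fredholm_minor_eq_sdet)
  next
    case False
    then show ?thesis by (simp add: fredholm_minor_eq_sdet)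
  qed
  have abs: "fredholm_minor A d abs_summable_on ({..<d} \<rightarrow>\<^sub>E S)" for d
  proof -
    have "(\<lambda>u. norm (fredholm_minor A d u)) summable_on ({..<d} \<rightarrow>\<^sub>E S) \<longleftrightarrow>
        (\<lambda>u. norm (fredholm_minor A d u)) summable_on U d"
    proof (rule summable_on_cong_neutral)
      show "norm (fredholm_minor A d u) = 0" if "u \<in> U d - ({..<d} \<rightarrow>\<^sub>E S)" for u
        using that U_sub by blast
    qed (simp_all add: zero)
    then show ?thesis using finU by simp
  qed
  have term_eq: "fredholm_term S A d = (\<Sum>Y\<in>{Y \<in> Pow W. card Y = d}. sdet Y A)" for d
  proof -
    have "(\<Sum>\<^sub>\<infinity>u\<in>{..<d} \<rightarrow>\<^sub>E S. fredholm_minor A d u) = (\<Sum>\<^sub>\<infinity>u\<in>U d. fredholm_minor A d u)"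
    proof (rule infsum_cong_neutral)
      show "fredholm_minor A d u = 0" if "u \<in> U d - ({..<d} \<rightarrow>\<^sub>E S)" for u
        using that U_sub by blast
    qed (simp_all add: zero)
    also have "\<dots> = (\<Sum>u\<in>U d. sdet (u ` {..<d}) A)"
      using finU by (simp add: fredholm_minor_eq_sdet U_def)
    also have "\<dots> = (\<Sum>Y\<in>{Y \<in> Pow W. card Y = d}. \<Sum>u\<in>{u \<in> U d. u ` {..<d} = Y}. sdet (u ` {..<d}) A)"
    proof (rule sum.group[symmetric])
      show "(\<lambda>u. u ` {..<d}) ` U d \<subseteq> {Y \<in> Pow W. card Y = d}"
      proof (intro image_subsetI CollectI conjI)
        fix u assume "u \<in> U d"
        then have u: "u \<in> {..<d} \<rightarrow>\<^sub>E W" "inj_on u {..<d}" by (simp_all add: U_def)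
        show "u ` {..<d} \<in> Pow W" using u(1) by blast
        show "card (u ` {..<d}) = d" using card_image[OF u(2)] by simp
      qed
      show "finite {Y \<in> Pow W. card Y = d}" using W(1) by simp
    qed (rule finU)
    also have "\<dots> = (\<Sum>Y\<in>{Y \<in> Pow W. card Y = d}. fact d * sdet Y A)"
    proof (rule sum.cong[OF refl])
      fix Y assume "Y \<in> {Y \<in> Pow W. card Y = d}"
      then have Y: "Y \<subseteq> W" "card Y = d" by auto
      have finY: "finite Y" using Y(1) W(1) by (rule finite_subset)
      have "{u \<in> U d. u ` {..<d} = Y} = {u \<in> {..<d} \<rightarrow>\<^sub>E Y. inj_on u {..<d}}"
      proof (intro equalityI subsetI)
        fix u assume "u \<in> {u \<in> U d. u ` {..<d} = Y}"
        then show "u \<in> {u \<in> {..<d} \<rightarrow>\<^sub>E Y. inj_on u {..<d}}"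
          by (auto simp: U_def PiE_def)
      next
        fix u assume u: "u \<in> {u \<in> {..<d} \<rightarrow>\<^sub>E Y. inj_on u {..<d}}"
        then have "u ` {..<d} \<subseteq> Y" "card (u ` {..<d}) = d"
          by (auto simp: card_image)
        then have "u ` {..<d} = Y"
          using finY Y(2) by (intro card_subset_eq) auto
        then show "u \<in> {u \<in> U d. u ` {..<d} = Y}"
          using u Y(1) by (auto simp: U_def)
      qed
      then have "card {u \<in> U d. u ` {..<d} = Y} = fact d"
        using card_injective_enumerations[OF finY Y(2)] by simp
      moreover have "(\<Sum>u\<in>{u \<in> U d. u ` {..<d} = Y}. sdet (u ` {..<d}) A) =
          (\<Sum>u\<in>{u \<in> U d. u ` {..<d} = Y}. sdet Y A)"
        by (rule sum.cong) auto
      ultimately show "(\<Sum>u\<in>{u \<in> U d. u ` {..<d} = Y}. sdet (u ` {..<d}) A) = fact d * sdet Y A"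
        by simp
    qed
    also have "\<dots> = fact d * (\<Sum>Y\<in>{Y \<in> Pow W. card Y = d}. sdet Y A)"
      by (rule sum_distrib_left[symmetric])
    finally show ?thesis
      by (simp add: fredholm_term_def)
  qed
  have large: "fredholm_term S A d = 0" if "d \<notin> {..card W}" for d
  proof -
    have none: "{Y \<in> Pow W. card Y = d} = {}"
      using that card_mono[OF W(1)] by auto
    show ?thesis unfolding term_eq none by simp
  qed
  have "summable (fredholm_term S A)"
    using large by (intro summable_finite[of "{..card W}"]) auto
  then show "fredholm_converges S A"
    using abs by (simp add: fredholm_converges_def)
  have "fredholm_det S A = (\<Sum>d\<le>card W. fredholm_term S A d)"
    unfolding fredholm_det_def using large by (intro suminf_finite) auto
  also have "\<dots> = (\<Sum>d\<in>{..card W}. \<Sum>Y\<in>{Y \<in> Pow W. card Y = d}. sdet Y A)"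
    by (simp add: term_eq)
  also have "\<dots> = (\<Sum>Y\<in>Pow W. sdet Y A)"
  proof (rule sum.group)
    show "card ` Pow W \<subseteq> {..card W}"
      using card_mono[OF W(1)] by blast
  qed (use W(1) in simp_all)
  finally show "fredholm_det S A = (\<Sum>Y\<in>Pow W. sdet Y A)" .
qed

context window_data
begin

lemma finite_configs_window: "finite {X \<in> configs N. Y \<subseteq> pts N X \<and> pts N X \<subseteq> W}"
proof (rule finite_imageD)
  show "finite (pts N ` {X \<in> configs N. Y \<subseteq> pts N X \<and> pts N X \<subseteq> W})"
    by (rule finite_subset[of _ "Pow W"]) (use finite_window in auto)
  show "inj_on (pts N) {X \<in> configs N. Y \<subseteq> pts N X \<and> pts N X \<subseteq> W}"
    by (rule inj_on_subset[OF inj_on_pts]) auto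
qed

text \<open>
  The complement in the window turns the deleted set \<open>S\<close> into the set of points that are present.
\<close>
lemma kernel_minor_eq_window_correlation:
  assumes Y: "Y \<subseteq> W" and N: "1 \<le> N"
  shows "sdet Y K = (\<Sum>X\<in>{X \<in> configs N. Y \<subseteq> pts N X \<and> pts N X \<subseteq> W}. signed_weight N q p r t y X)"
proof -
  let ?C = "{X \<in> configs N. Y \<subseteq> pts N X \<and> pts N X \<subseteq> W}"
  let ?D = "(-1) ^ N * (\<Prod>k = 1..N. Mij k k)"
  have D: "?D \<noteq> 0" using Mij_diagonal_nonzero by simp
  have disj: "V \<inter> W = {}" by (rule virtuals_window_disjoint)
  have inj: "inj_on (\<lambda>X. W - pts N X) ?C"
  proof (rule inj_onI)
    fix X X' assume X: "X \<in> ?C" "X' \<in> ?C" "W - pts N X = W - pts N X'"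
    then have "pts N X = pts N X'" by blast
    then show "X = X'" using inj_onD[OF inj_on_pts] X by auto
  qed
  have "(\<Sum>S\<in>Pow (W - Y). sdet (V \<union> W - S) Lmat) = (\<Sum>S\<in>(\<lambda>X. W - pts N X) ` ?C. sdet (V \<union> W - S) Lmat)"
  proof (rule sum.mono_neutral_right)
    show "finite (Pow (W - Y))" using finite_window by simp
    show "(\<lambda>X. W - pts N X) ` ?C \<subseteq> Pow (W - Y)" by blast
    show "\<forall>S\<in>Pow (W - Y) - (\<lambda>X. W - pts N X) ` ?C. sdet (V \<union> W - S) Lmat = 0"
    proof (rule ballI, rule ccontr)
      fix S assume S: "S \<in> Pow (W - Y) - (\<lambda>X. W - pts N X) ` ?C" and nz: "sdet (V \<union> W - S) Lmat \<noteq> 0"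
      have "V \<union> W - S = V \<union> (W - S)" using S disj by blast
      then obtain X where X: "X \<in> configs N" "pts N X = W - S"
        using nonzero_minor_imp_config[of "W - S" lo hi] nz by auto
      then have "X \<in> ?C" using S Y by auto
      moreover have "S = W - pts N X" using S X(2) by auto
      ultimately show False using S by blast
    qed
  qed
  also have "\<dots> = (\<Sum>X\<in>?C. sdet (V \<union> W - (W - pts N X)) Lmat)"
    by (simp add: sum.reindex[OF inj])
  also have "\<dots> = (\<Sum>X\<in>?C. ?D * signed_weight N q p r t y X)"
  proof (rule sum.cong[OF refl])
    fix X assume X: "X \<in> ?C"
    then have "V \<union> W - (W - pts N X) = V \<union> pts N X" using disj by blast
    then show "sdet (V \<union> W - (W - pts N X)) Lmat = ?D * signed_weight N q p r t y X"
      using pts_minor_eq_weight[of X] X N by simp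
  qed
  also have "\<dots> = ?D * (\<Sum>X\<in>?C. signed_weight N q p r t y X)"
    by (rule sum_distrib_left[symmetric])
  finally have "?D * sdet Y K = ?D * (\<Sum>X\<in>?C. signed_weight N q p r t y X)"
    using sum_minors_eq_kernel_minor[OF Y] unfolding sdet_Amat by simp
  then show ?thesis using D by (simp only: mult_cancel_left) simp
qed

text \<open>
  The top row lies in \<open>{lo..hi}\<close>, which contains the supports of the functions \<open>\<Psi>\<close>, since otherwise a column
  of the last determinant vanishes; interlacing bounds every lower particle by particles of the top row.
\<close>
lemma weight_nonzero_imp_in_window:
  assumes X: "X \<in> configs N" and nz: "signed_weight N q p r t y X \<noteq> 0"
  shows "pts N X \<subseteq> W"
proof -
  have top: "lo \<le> X (N, j) \<and> X (N, j) \<le> hi" if j: "j \<in> {1..N}" for j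
  proof -
    have "det (mat_of1 N (\<lambda>i j. PsiTop i (X (N, j)))) \<noteq> 0"
      using nz by (auto simp: signed_weight_def)
    then have "sdet {0..<N} (\<lambda>a b. PsiTop (a + 1) (X (N, b + 1))) \<noteq> 0"
      by (simp add: mat_of1_def flip: det_eq_sdet)
    then obtain \<pi> where \<pi>: "\<pi> permutes {0..<N}"
      "\<And>a. a \<in> {0..<N} \<Longrightarrow> PsiTop (a + 1) (X (N, \<pi> a + 1)) \<noteq> 0"
      using sdet_nonzero_imp_permutation[of "{0..<N}"] by blast
    have "j - 1 \<in> \<pi> ` {0..<N}"
      using permutes_image[OF \<pi>(1)] j by auto
    then obtain a where a: "a \<in> {0..<N}" "\<pi> a = j - 1" by auto
    then have "PsiTop (a + 1) (X (N, j)) \<noteq> 0"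
      using \<pi>(2)[OF a(1)] j by auto
    then show ?thesis using support[of "a + 1"] a(1) by auto
  qed
  have interlace: "X (Suc i, Suc j) < X (i, j) \<and> X (i, j) \<le> X (Suc i, j)" if "1 \<le> j" "j \<le> i" "i < N" for i j
    using X that by (auto simp: configs_def)
  have upper: "X (i, j) \<le> hi" if "i \<le> N" "1 \<le> j" "j \<le> i" for i j
    using that
  proof (induction i rule: inc_induct)
    case base
    then show ?case using top[of j] by auto
  next
    case (step i)
    then show ?case using interlace[of j i] by auto
  qed
  have lower: "lo \<le> X (i, j)" if "i \<le> N" "1 \<le> j" "j \<le> i" for i j
    using that
  proof (induction i arbitrary: j rule: inc_induct)
    case base
    then show ?case using top[of j] by auto
  next
    case (step i)
    have "lo \<le> X (Suc i, Suc j)"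
      using step.prems by (intro step.IH) auto
    then show ?case using interlace[of j i] step.prems step.hyps by auto
  qed
  show ?thesis
    using upper lower by (auto simp: pts_def window_def tri_index_def)
qed

end

text \<open>
  The correlation identity holds in every window with the support property, so \<open>Y\<close> may be arbitrary: the window
  is enlarged to contain it, and the configurations gained have weight zero. In particular the minors
  of \<open>K\<close> at sets outside one fixed finite set vanish.
\<close>
lemma (in interlacing_data) kernel_minors_are_correlations:
  assumes N: "1 \<le> N"
  obtains W where "finite W" "W \<subseteq> {1..N} \<times> UNIV" "finite {X \<in> configs N. pts N X \<subseteq> W}"
    "\<And>X. X \<in> configs N \<Longrightarrow> signed_weight N q p r t y X \<noteq> 0 \<Longrightarrow> pts N X \<subseteq> W"
    "\<And>Y. finite Y \<Longrightarrow> Y \<subseteq> {1..N} \<times> UNIV \<Longrightarrow>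
      sdet Y K = (\<Sum>X\<in>{X \<in> configs N. pts N X \<subseteq> W \<and> Y \<subseteq> pts N X}. signed_weight N q p r t y X)"
proof -
  obtain lo hi where support: "\<And>k x. k \<in> {1..N} \<Longrightarrow> PsiN N q p r t y k x \<noteq> 0 \<Longrightarrow> lo \<le> x \<and> x \<le> hi"
    using PsiN_finite_support[of N q p r t y] by blast
  interpret W0: window_data N r t p q y lo hi
    by unfold_locales (rule support)
  let ?W = "window N lo hi"
  show ?thesis
  proof (rule that[of ?W])
    show "finite ?W" by (rule finite_window)
    show "?W \<subseteq> {1..N} \<times> UNIV" by (auto simp: window_def)
    show "finite {X \<in> configs N. pts N X \<subseteq> ?W}"
      using W0.finite_configs_window[of "{}"] by simp
    show "pts N X \<subseteq> ?W" if "X \<in> configs N" "signed_weight N q p r t y X \<noteq> 0" for X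
      using W0.weight_nonzero_imp_in_window[OF that] .
    fix Y :: "(nat \<times> int) set" assume Y: "finite Y" "Y \<subseteq> {1..N} \<times> UNIV"
    define a where "a = Min (insert lo (snd ` Y))"
    define b where "b = Max (insert hi (snd ` Y))"
    have ab: "a \<le> lo" "hi \<le> b" "\<And>v. v \<in> Y \<Longrightarrow> a \<le> snd v \<and> snd v \<le> b"
      using Y(1) by (auto simp: a_def b_def)
    interpret W1: window_data N r t p q y a b
      by unfold_locales (use support ab in fastforce)
    let ?W1 = "window N a b"
    have sub: "?W \<subseteq> ?W1" using ab by (auto simp: window_def)
    have "Y \<subseteq> ?W1"
    proof
      fix v assume "v \<in> Y"
      then show "v \<in> ?W1" using ab(3)[of v] Y(2) by (cases v) (auto simp: window_def)
    qed
    then have "sdet Y K = (\<Sum>X\<in>{X \<in> configs N. Y \<subseteq> pts N X \<and> pts N X \<subseteq> ?W1}. signed_weight N q p r t y X)"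
      using N by (rule W1.kernel_minor_eq_window_correlation)
    also have "\<dots> = (\<Sum>X\<in>{X \<in> configs N. pts N X \<subseteq> ?W \<and> Y \<subseteq> pts N X}. signed_weight N q p r t y X)"
    proof (rule sum.mono_neutral_right)
      show "finite {X \<in> configs N. Y \<subseteq> pts N X \<and> pts N X \<subseteq> ?W1}"
        by (rule W1.finite_configs_window)
      show "{X \<in> configs N. pts N X \<subseteq> ?W \<and> Y \<subseteq> pts N X} \<subseteq> {X \<in> configs N. Y \<subseteq> pts N X \<and> pts N X \<subseteq> ?W1}"
        using sub by blast
      show "\<forall>X\<in>{X \<in> configs N. Y \<subseteq> pts N X \<and> pts N X \<subseteq> ?W1} - {X \<in> configs N. pts N X \<subseteq> ?W \<and> Y \<subseteq> pts N X}.
          signed_weight N q p r t y X = 0"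
        using W0.weight_nonzero_imp_in_window by blast
    qed
    finally show "sdet Y K = (\<Sum>X\<in>{X \<in> configs N. pts N X \<subseteq> ?W \<and> Y \<subseteq> pts N X}. signed_weight N q p r t y X)" .
  qed
qed

text \<open>
  Expand the product over the subsets \<open>Y\<close> of the configuration and exchange the two finite sums.
\<close>
lemma (in interlacing_data) fredholm_representation:
  fixes g :: "nat \<times> int \<Rightarrow> real"
  assumes N: "1 \<le> N"
  defines "F \<equiv> \<lambda>X. \<Prod>(i, j)\<in>tri_index N. 1 + g (i, X (i, j))"
    and "gK \<equiv> \<lambda>u v. g u * K u v"
  shows "(\<lambda>X. F X * signed_weight N q p r t y X) abs_summable_on configs N"
    and "fredholm_converges ({1..N} \<times> UNIV) gK"
    and "signed_expectation N q p r t y F = fredholm_det ({1..N} \<times> UNIV) gK"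
proof -
  obtain W where W: "finite W" "W \<subseteq> {1..N} \<times> UNIV" "finite {X \<in> configs N. pts N X \<subseteq> W}"
    "\<And>X. X \<in> configs N \<Longrightarrow> signed_weight N q p r t y X \<noteq> 0 \<Longrightarrow> pts N X \<subseteq> W"
    "\<And>Y. finite Y \<Longrightarrow> Y \<subseteq> {1..N} \<times> UNIV \<Longrightarrow>
      sdet Y K = (\<Sum>X\<in>{X \<in> configs N. pts N X \<subseteq> W \<and> Y \<subseteq> pts N X}. signed_weight N q p r t y X)"
    by (rule kernel_minors_are_correlations[OF N]) (rule that, assumption+)
  let ?w = "signed_weight N q p r t y"
  let ?C = "{X \<in> configs N. pts N X \<subseteq> W}"
  have zero: "?w X = 0" if "X \<in> configs N - ?C" for X
    using W(4) that by blast
  show "(\<lambda>X. F X * ?w X) abs_summable_on configs N"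
  proof -
    have "(\<lambda>X. norm (F X * ?w X)) summable_on configs N \<longleftrightarrow> (\<lambda>X. norm (F X * ?w X)) summable_on ?C"
      using zero by (intro summable_on_cong_neutral) auto
    then show ?thesis using W(3) by simp
  qed
  have gK: "sdet Y gK = (\<Prod>u\<in>Y. g u) * sdet Y K" for Y
    unfolding gK_def by (rule sdet_scale_rows)
  have vanish: "sdet Y gK = 0" if Y: "finite Y" "Y \<subseteq> {1..N} \<times> UNIV" "\<not> Y \<subseteq> W" for Y
  proof -
    have none: "{X \<in> configs N. pts N X \<subseteq> W \<and> Y \<subseteq> pts N X} = {}" using Y(3) by blast
    show ?thesis unfolding gK W(5)[OF Y(1,2)] none by simp
  qed
  show "fredholm_converges ({1..N} \<times> UNIV) gK"
    by (rule fredholm_finitely_supported_minors(1)[OF W(1,2) vanish])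
  have F: "F X = (\<Sum>Y\<in>Pow (pts N X). \<Prod>u\<in>Y. g u)" if X: "X \<in> configs N" for X
  proof -
    have "F X = (\<Prod>u\<in>pts N X. g u + 1)"
      unfolding pts_def by (subst prod.reindex[OF inj_on_tri_index[OF X]])
        (auto simp: F_def split_def add.commute)
    also have "\<dots> = (\<Sum>Y\<in>Pow (pts N X). \<Prod>u\<in>Y. g u)"
      by (subst prod_add) (simp_all add: finite_pts)
    finally show ?thesis .
  qed
  have "signed_expectation N q p r t y F = (\<Sum>\<^sub>\<infinity>X\<in>?C. F X * ?w X)"
    unfolding signed_expectation_def using zero by (intro infsum_cong_neutral) auto
  also have "\<dots> = (\<Sum>X\<in>?C. F X * ?w X)"
    using W(3) by simp
  also have "\<dots> = (\<Sum>X\<in>?C. \<Sum>Y\<in>Pow W. if Y \<subseteq> pts N X then (\<Prod>u\<in>Y. g u) * ?w X else 0)"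
  proof (rule sum.cong[OF refl])
    fix X assume X: "X \<in> ?C"
    have "F X * ?w X = (\<Sum>Y\<in>Pow (pts N X). (\<Prod>u\<in>Y. g u) * ?w X)"
      using X by (simp add: F sum_distrib_right)
    also have "\<dots> = (\<Sum>Y\<in>Pow W. if Y \<subseteq> pts N X then (\<Prod>u\<in>Y. g u) * ?w X else 0)"
      using X W(1) by (intro sum.mono_neutral_cong_left) auto
    finally show "F X * ?w X = (\<Sum>Y\<in>Pow W. if Y \<subseteq> pts N X then (\<Prod>u\<in>Y. g u) * ?w X else 0)" .
  qed
  also have "\<dots> = (\<Sum>Y\<in>Pow W. \<Sum>X\<in>?C. if Y \<subseteq> pts N X then (\<Prod>u\<in>Y. g u) * ?w X else 0)"
    by (rule sum.swap)
  also have "\<dots> = (\<Sum>Y\<in>Pow W. sdet Y gK)"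
  proof (rule sum.cong[OF refl])
    fix Y assume "Y \<in> Pow W"
    then have Y: "finite Y" "Y \<subseteq> {1..N} \<times> UNIV"
      using W(1,2) finite_subset by auto
    have "(\<Sum>X\<in>?C. if Y \<subseteq> pts N X then (\<Prod>u\<in>Y. g u) * ?w X else 0) =
        (\<Sum>X\<in>{X \<in> configs N. pts N X \<subseteq> W \<and> Y \<subseteq> pts N X}. (\<Prod>u\<in>Y. g u) * ?w X)"
      using W(3) by (intro sum.mono_neutral_cong_right) auto
    then show "(\<Sum>X\<in>?C. if Y \<subseteq> pts N X then (\<Prod>u\<in>Y. g u) * ?w X else 0) = sdet Y gK"
      unfolding gK W(5)[OF Y] by (simp add: sum_distrib_left)
  qed
  also have "\<dots> = fredholm_det ({1..N} \<times> UNIV) gK"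
    by (rule fredholm_finitely_supported_minors(2)[OF W(1,2) vanish, symmetric])
  finally show "signed_expectation N q p r t y F = fredholm_det ({1..N} \<times> UNIV) gK" .
qed

theorem proposition3p10:
  fixes N r t :: nat and p q :: "nat \<Rightarrow> real" and y :: "nat \<Rightarrow> int"
  assumes "N \<ge> 2"
    and "\<forall>i\<ge>1. p i > 0"
    and "r < t"
    and "\<forall>i j. 1 \<le> i \<and> i \<le> j \<and> j \<le> N \<longrightarrow> y i \<ge> y j"
    and "1 < q 1"
    and "\<forall>i. 1 \<le> i \<and> i < N \<longrightarrow> q i < q (i + 1)"
  shows "upper_triangular (Mmat N q p r t y) \<and> invertible_mat (Mmat N q p r t y) \<and>
    (\<forall>g :: nat \<times> int \<Rightarrow> real. (\<exists>B. \<forall>i\<in>{1..N}. \<forall>x. \<bar>g (i, x)\<bar> \<le> B) \<longrightarrow>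
      (let F = (\<lambda>X. \<Prod>(i, j)\<in>tri_index N. 1 + g (i, X (i, j)));
           gK = (\<lambda>u v. g u * corr_kernel N q p r t y u v)
       in (\<lambda>X. F X * signed_weight N q p r t y X) abs_summable_on configs N \<and>
          fredholm_converges ({1..N} \<times> UNIV) gK \<and>
          signed_expectation N q p r t y F = fredholm_det ({1..N} \<times> UNIV) gK))"
proof -
  have less: "q i < q j" if "1 \<le> i" "i < j" "j \<le> N" for i j
  proof -
    have "q i < q (i + Suc k)" if "i + Suc k \<le> N" for k
      using that
    proof (induction k)
      case 0
      then show ?case using assms(6) \<open>1 \<le> i\<close> by auto
    next
      case (Suc k)
      then have "q i < q (i + Suc k)" by simp
      also have "\<dots> < q (i + Suc (Suc k))"
        using assms(6) \<open>1 \<le> i\<close> Suc.prems by auto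
      finally show ?case .
    qed
    from this[of "j - i - 1"] show ?thesis using that by auto
  qed
  interpret interlacing_data N r t p q y
  proof
    show "0 < q i" if "i \<in> {1..N}" for i
      using less[of 1 i] that assms(5) by (cases "i = 1") auto
  qed (use less assms(2) in auto)
  have "1 \<le> N" using assms(1) by simp
  show ?thesis
    unfolding Let_def
    by (intro conjI allI impI Mmat_upper_triangular Mmat_invertible fredholm_representation[OF \<open>1 \<le> N\<close>])
qed

end
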